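(* Let $[a,b]\subset\mathbb{R}$, let $\mathcal{B}$ be the Borel $\sigma$-algebra of $[a,b]$, and let $\mu:\mathcal{B}\to L_0(\Omega,\mathcal{F},\mathsf{P})$ be a stochastic measure. Suppose that the process $\mu(t)=\mu([a,t])$, $a\le t\le b$, has continuous paths. Then for any $p\ge 2$ and any $0<\alpha<1/p$, with probability 1 the path $t\mapsto\mu(t)$ belongs to the Besov space $B^{\alpha}_{pp}([a,b])$.
   Context: $(\Omega,\mathcal{F},\mathsf{P})$ is a probability space and $L_0=L_0(\Omega,\mathcal{F},\mathsf{P})$ is the set of all (equivalence classes modulo a.s. equality of) real-valued random variables on it, with the topology of convergence in probability. For a set $\mathsf{X}$ and a $\sigma$-algebra $\mathcal{B}$ of subsets of $\mathsf{X}$, a stochastic measure is a $\sigma$-additive mapping $\mu:\mathcal{B}\to L_0$, i.e. for pairwise disjoint $A_1,A_2,\dots\in\mathcal{B}$ one has $\mu(\bigcup_n A_n)=\sum_n\mu(A_n)$ with the series converging in probability. Neither positivity nor existence of moments is assumed. Since $\mu(t)$ is a priori an equivalence class for each $t$, the process $\mu(t)$, $a\le t\le b$, is understood as a family of random variables in which, for each $t$, the random variable $\mu(t)$ is a representative of $\mu([a,t])$; "continuous paths" means that the functions $t\mapsto\mu(t)(\omega)$ are continuous on $[a,b]$. Besov space: for $1\le p,q<\infty$ and $0<\alpha<1$, $B^{\alpha}_{pq}([a,b])$ is the space of functions $f:[a,b]\to\mathbb{R}$ with finite norm \[ \|f\|^{\alpha}_{p,q}=\|f\|_{L_p([a,b])}+\left(\int_0^{b-a}\left(w_p(t,f)\right)^q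 t^{-\alpha q-1}\,dt\right)^{1/q}, \] where \[ w_p(t,f)=\sup_{|h|\le t}\left(\int_{I_h}|f(x-h)-f(x)|^p\,dx\right)^{1/p},\qquad I_h=\{x\in[a,b]:\ x-h\in[a,b]\}. \] In the claim, $q=p$. *)

theory Defs
  imports "HOL-Probability.Probability"
begin

text \<open>
  Elements of \<open>L\<^sub>0\<close> are handled through representatives: measurable real functions on the
  probability space. All notions below that concern \<open>L\<^sub>0\<close> are invariant under changing each
  representative on a null set.
\<close>

definition tendsto_in_probability ::
    "'w measure \<Rightarrow> (nat \<Rightarrow> 'w \<Rightarrow> real) \<Rightarrow> ('w \<Rightarrow> real) \<Rightarrow> bool" where
  "tendsto_in_probability M Y Z \<longleftrightarrow>
     (\<forall>\<epsilon>>0. (\<lambda>n. measure M {\<omega> \<in> space M. \<bar>Y n \<omega> - Z \<omega>\<bar> > \<epsilon>}) \<longlonglongrightarrow> 0)"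

definition sums_in_probability ::
    "'w measure \<Rightarrow> (nat \<Rightarrow> 'w \<Rightarrow> real) \<Rightarrow> ('w \<Rightarrow> real) \<Rightarrow> bool" where
  "sums_in_probability M Y Z \<longleftrightarrow> tendsto_in_probability M (\<lambda>n \<omega>. \<Sum>k<n. Y k \<omega>) Z"

definition stochastic_measure ::
    "'w measure \<Rightarrow> 'x set \<Rightarrow> 'x set set \<Rightarrow> ('x set \<Rightarrow> 'w \<Rightarrow> real) \<Rightarrow> bool" where
  "stochastic_measure M X B \<mu> \<longleftrightarrow>
     sigma_algebra X B \<and>
     (\<forall>A\<in>B. \<mu> A \<in> borel_measurable M) \<and>
     (\<forall>A :: nat \<Rightarrow> 'x set. range A \<subseteq> B \<longrightarrow> disjoint_family A \<longrightarrow>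
        sums_in_probability M (\<lambda>n. \<mu> (A n)) (\<mu> (\<Union>n. A n)))"

text \<open>
  The Besov norm is an extended nonnegative number, so that divergent integrals are infinite
  rather than zero. The power below is only used for exponents \<open>r > 0\<close>.
\<close>

definition ennpowr :: "ennreal \<Rightarrow> real \<Rightarrow> ennreal" where
  "ennpowr x r = (if x = \<infinity> then \<infinity> else ennreal (enn2real x powr r))"

definition Lp_norm :: "real \<Rightarrow> real \<Rightarrow> real \<Rightarrow> (real \<Rightarrow> real) \<Rightarrow> ennreal" where
  "Lp_norm p a b f = ennpowr (\<integral>\<^sup>+x\<in>{a..b}. ennreal (\<bar>f x\<bar> powr p) \<partial>lebesgue) (1 / p)"

definition Lp_modulus :: "real \<Rightarrow> real \<Rightarrow> real \<Rightarrow> real \<Rightarrow> (real \<Rightarrow> real) \<Rightarrow> ennreal" where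
  "Lp_modulus p a b t f =
     (SUP h\<in>{h. \<bar>h\<bar> \<le> t}.
        ennpowr (\<integral>\<^sup>+x\<in>{x \<in> {a..b}. x - h \<in> {a..b}}. ennreal (\<bar>f (x - h) - f x\<bar> powr p) \<partial>lebesgue)
          (1 / p))"

definition besov_norm ::
    "real \<Rightarrow> real \<Rightarrow> real \<Rightarrow> real \<Rightarrow> real \<Rightarrow> (real \<Rightarrow> real) \<Rightarrow> ennreal" where
  "besov_norm \<alpha> p q a b f =
     Lp_norm p a b f +
     ennpowr (\<integral>\<^sup>+t\<in>{0<..b - a}. ennpowr (Lp_modulus p a b t f) q * ennreal (t powr (- \<alpha> * q - 1)) \<partial>lebesgue)
       (1 / q)"

text \<open>Only the values of a function on \<open>[a, b]\<close> matter for membership.\<close>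

definition besov_space :: "real \<Rightarrow> real \<Rightarrow> real \<Rightarrow> real \<Rightarrow> real \<Rightarrow> (real \<Rightarrow> real) set" where
  "besov_space \<alpha> p q a b =
     {f \<in> borel_measurable (lebesgue_on {a..b}). besov_norm \<alpha> p q a b f < \<infinity>}"

end

theory Submission
  imports Defs
begin

text \<open>
  \<^bold>\<open>Reduction to dyadic square sums.\<close> Let \<open>V n\<close> be the sum of the squared increments of a path over the \<open>2 ^ n\<close>
  dyadic intervals of level \<open>n\<close>. If \<open>V n\<close> grows at most like \<open>2 powr (\<epsilon> * n)\<close>, then chaining through
  the dyadic step functions that interpolate the path gives
  \<open>\<integral> \<bar>f (x - h) - f x\<bar>\<^sup>2 dx = O(t powr (1 - \<epsilon>))\<close> for \<open>\<bar>h\<bar> \<le> t\<close>. A continuous path is bounded, so for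
  \<open>p \<ge> 2\<close> the same bound holds for the \<open>p\<close>-th powers, and the Besov integral converges as soon as
  \<open>\<alpha> * p < 1 - \<epsilon>\<close> (\<open>translate_power\<close>, \<open>besov\<close>). Since \<open>\<alpha> * p < 1\<close>, such an \<open>\<epsilon> > 0\<close> exists.

  \<^bold>\<open>The square sums.\<close> It remains to show that almost surely \<open>V n = O(2 powr (\<epsilon> * n))\<close> for every
  \<open>\<epsilon> > 0\<close>. With weights \<open>w n\<close> proportional to \<open>2 powr (- \<epsilon> * n / 2)\<close> and of total mass at most \<open>1\<close>,
  it suffices that the energy \<open>\<Sum>n. w n\<^sup>2 * V n\<close> is almost surely finite (\<open>energy_finite\<close>). The
  property of the stochastic measure that forces this is that its values on a disjoint sequence of
  sets tend to zero in probability.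

  Suppose the energy is infinite on an event of positive probability. Switch finitely
  many cells from many levels on or off by independent fair coins, and give the cells of level \<open>n\<close> the weight
  \<open>w n\<close>. For each outcome in that event, the weighted sum of the increments over the cells that are on is huge
  with probability bounded below, by the Paley-Zygmund inequality; hence
  some fixed choice of the coins gives coefficients in \<open>[0, 1]\<close> for which the corresponding linear
  combination of increments is huge with probability bounded below (\<open>random_signs\<close>). Next, pass to
  a level so fine that all increments are small, which is possible because paths are continuous,
  and keep each fine cell independently with probability \<open>\<theta>\<close> times its coefficient. The mean of the
  resulting sum of increments is still huge, and because the single terms are small the
  Paley-Zygmund inequality applies once more, with a constant that does not depend on \<open>\<theta>\<close>: a set \<open>B\<close> of
  cells is found whose increment exceeds \<open>1\<close> in absolute value with probability bounded
  below. On the other hand, an outcome of infinite energy has infinite energy already in one fine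
  cell, and this cell is put into \<open>B\<close> with probability at most \<open>\<theta>\<close>. So for small \<open>\<theta>\<close> the complement
  of \<open>B\<close> still carries infinite energy with almost the same probability (\<open>thinning\<close>), and the step
  can be repeated inside the complement. This yields infinitely many disjoint sets whose measures
  do not tend to zero in probability, a contradiction.
\<close>

section \<open>Random subsets of a finite set\<close>

text \<open>
  The probability of the outcome \<open>A\<close> when each \<open>i \<in> I\<close> is selected independently with
  probability \<open>a i\<close>. Finite sums with these weights replace a second probability space: only existence of a
  good outcome and exchange with the expectation over \<open>M\<close> are needed.
\<close>
definition subset_weight :: "('i \<Rightarrow> real) \<Rightarrow> 'i set \<Rightarrow> 'i set \<Rightarrow> real" where
  "subset_weight a I A = (\<Prod>i\<in>A. a i) * (\<Prod>i\<in>I - A. 1 - a i)"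

definition subset_mean :: "('i \<Rightarrow> real) \<Rightarrow> 'i set \<Rightarrow> ('i set \<Rightarrow> real) \<Rightarrow> real" where
  "subset_mean a I F = (\<Sum>A\<in>Pow I. subset_weight a I A * F A)"

lemma subset_weight_nonneg:
  assumes "\<And>i. i \<in> I \<Longrightarrow> 0 \<le> a i \<and> a i \<le> 1" "A \<subseteq> I"
  shows "0 \<le> subset_weight a I A"
  unfolding subset_weight_def using assms by (intro mult_nonneg_nonneg prod_nonneg) auto

lemma subset_mean_empty [simp]: "subset_mean a {} F = F {}"
  by (simp add: subset_mean_def subset_weight_def)

lemma subset_mean_insert:
  assumes "finite I" "i \<notin> I"
  shows "subset_mean a (insert i I) F =
    a i * subset_mean a I (\<lambda>A. F (insert i A)) + (1 - a i) * subset_mean a I F"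
proof -
  have fin: "finite A" if "A \<in> Pow I" for A using that assms finite_subset by auto
  have 1: "(\<Sum>A\<in>insert i ` Pow I. subset_weight a (insert i I) A * F A)
      = a i * subset_mean a I (\<lambda>A. F (insert i A))"
  proof -
    have "inj_on (insert i) (Pow I)" using assms(2) by (auto simp: inj_on_def)
    then have "(\<Sum>A\<in>insert i ` Pow I. subset_weight a (insert i I) A * F A)
       = (\<Sum>A\<in>Pow I. subset_weight a (insert i I) (insert i A) * F (insert i A))"
      by (simp add: sum.reindex)
    also have "\<dots> = (\<Sum>A\<in>Pow I. a i * (subset_weight a I A * F (insert i A)))"
    proof (rule sum.cong[OF refl])
      fix A assume A: "A \<in> Pow I"
      then have "i \<notin> A" "insert i I - insert i A = I - A" using assms(2) by auto
      then show "subset_weight a (insert i I) (insert i A) * F (insert i A)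
          = a i * (subset_weight a I A * F (insert i A))"
        using fin[OF A] by (simp add: subset_weight_def)
    qed
    finally show ?thesis by (simp add: subset_mean_def sum_distrib_left)
  qed
  have 2: "(\<Sum>A\<in>Pow I. subset_weight a (insert i I) A * F A) = (1 - a i) * subset_mean a I F"
  proof -
    have "subset_weight a (insert i I) A * F A = (1 - a i) * (subset_weight a I A * F A)"
      if A: "A \<in> Pow I" for A
    proof -
      have "insert i I - A = insert i (I - A)" "i \<notin> I - A" using A assms(2) by auto
      then show ?thesis using assms(1) by (simp add: subset_weight_def)
    qed
    then have "(\<Sum>A\<in>Pow I. subset_weight a (insert i I) A * F A)
        = (\<Sum>A\<in>Pow I. (1 - a i) * (subset_weight a I A * F A))"
      by (intro sum.cong refl)
    then show ?thesis by (simp add: subset_mean_def sum_distrib_left)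
  qed
  have "Pow I \<inter> insert i ` Pow I = {}" using assms(2) by auto
  then show ?thesis
    unfolding subset_mean_def[of a "insert i I"] Pow_insert
    using assms(1) 1 2 by (subst sum.union_disjoint) auto
qed

lemma subset_mean_add:
  "subset_mean a I (\<lambda>A. F A + G A) = subset_mean a I F + subset_mean a I G"
  by (simp add: subset_mean_def sum.distrib algebra_simps)

lemma subset_mean_cmult:
  "subset_mean a I (\<lambda>A. c * F A) = c * subset_mean a I F"
  by (simp add: subset_mean_def sum_distrib_left algebra_simps)

lemma subset_mean_const:
  assumes "finite I" shows "subset_mean a I (\<lambda>A. c) = c"
  using assms by (induction I rule: finite_induct) (auto simp: subset_mean_insert algebra_simps)

lemma subset_mean_mono:
  assumes "\<And>i. i \<in> I \<Longrightarrow> 0 \<le> a i \<and> a i \<le> 1"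
    and "\<And>A. A \<subseteq> I \<Longrightarrow> F A \<le> G A"
  shows "subset_mean a I F \<le> subset_mean a I G"
  unfolding subset_mean_def
  by (intro sum_mono mult_left_mono) (use assms subset_weight_nonneg in \<open>auto intro: subset_weight_nonneg\<close>)

lemma subset_mean_cong:
  assumes "\<And>A. A \<subseteq> I \<Longrightarrow> F A = G A"
  shows "subset_mean a I F = subset_mean a I G"
  unfolding subset_mean_def using assms by (intro sum.cong) auto

lemma subset_mean_member:
  assumes "finite I" "k \<in> I"
  shows "subset_mean a I (\<lambda>A. of_bool (k \<in> A)) = a k"
proof -
  obtain J where J: "I = insert k J" "k \<notin> J" using assms(2) mk_disjoint_insert by metis
  then have fin: "finite J" using assms by simp
  have "subset_mean a J (\<lambda>A. of_bool (k \<in> A)) = subset_mean a J (\<lambda>A. 0)"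
    using J by (intro subset_mean_cong) auto
  then show ?thesis unfolding J using J(2) fin
    by (simp add: subset_mean_insert subset_mean_const)
qed

lemma subset_mean_attained:
  assumes a: "\<And>i. i \<in> I \<Longrightarrow> 0 \<le> a i \<and> a i \<le> 1" and fin: "finite I"
    and c: "c \<le> subset_mean a I F"
  obtains A where "A \<subseteq> I" "c \<le> F A"
proof (rule ccontr)
  assume "\<not> thesis"
  then have *: "\<And>A. A \<subseteq> I \<Longrightarrow> F A < c" by (meson not_le that)
  define m where "m = Max (F ` Pow I)"
  have m: "F A \<le> m" if "A \<subseteq> I" for A
    unfolding m_def using that fin by (intro Max_ge) auto
  have "m \<in> F ` Pow I" unfolding m_def using fin by (intro Max_in) auto
  then have "m < c" using * by auto
  moreover have "subset_mean a I F \<le> subset_mean a I (\<lambda>A. m)"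
    by (rule subset_mean_mono[OF a m])
  ultimately show False using c subset_mean_const[OF fin, of a m] by linarith
qed

text \<open>
  Adding one independent centred term \<open>\<zeta>\<close> to \<open>T\<close> changes the fourth moment by
  \<open>6 * E T\<^sup>2 * E \<zeta>\<^sup>2 + E \<zeta>^4\<close>, since the terms with \<open>E \<zeta>\<close> and \<open>E T\<close> vanish. The first summand is
  the cross term of \<open>3 * (E T\<^sup>2 + E \<zeta>\<^sup>2)\<^sup>2\<close>, which gives the induction.
\<close>
lemma subset_moments:
  fixes y :: "'i \<Rightarrow> real"
  assumes "finite I" and "\<And>i. i \<in> I \<Longrightarrow> 0 \<le> a i \<and> a i \<le> 1"
  defines "T \<equiv> \<lambda>I A. (\<Sum>i\<in>A. y i) - (\<Sum>i\<in>I. a i * y i)"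
  defines "v \<equiv> \<lambda>I. \<Sum>i\<in>I. a i * (1 - a i) * (y i)\<^sup>2"
  shows "subset_mean a I (T I) = 0 \<and> subset_mean a I (\<lambda>A. (T I A)\<^sup>2) = v I \<and>
    subset_mean a I (\<lambda>A. (T I A)^4) \<le> 3 * (v I)\<^sup>2 + (\<Sum>i\<in>I. a i * (1 - a i) * (y i)^4)"
  using assms(1,2)
proof (induction I rule: finite_induct)
  case empty
  then show ?case by (simp add: T_def v_def)
next
  case (insert i I)
  let ?E = "subset_mean a I"
  let ?b = "a i" and ?y = "y i"
  have IH: "?E (T I) = 0" "?E (\<lambda>A. (T I A)\<^sup>2) = v I"
    "?E (\<lambda>A. (T I A)^4) \<le> 3 * (v I)\<^sup>2 + (\<Sum>i\<in>I. a i * (1 - a i) * (y i)^4)"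
    using insert by auto
  have b: "0 \<le> ?b" "?b \<le> 1" using insert.prems by auto
  have T1: "T (insert i I) (insert i A) = T I A + (1 - ?b) * ?y" if "A \<subseteq> I" for A
  proof -
    have "i \<notin> A" "finite A" using that insert.hyps finite_subset by auto
    then show ?thesis using insert.hyps by (simp add: T_def algebra_simps)
  qed
  have T0: "T (insert i I) A = T I A + (- (?b * ?y))" for A
    using insert.hyps by (simp add: T_def algebra_simps)
  have v: "v (insert i I) = v I + ?b * (1 - ?b) * ?y\<^sup>2"
    using insert.hyps by (simp add: v_def)
  have ins: "subset_mean a (insert i I) (\<lambda>A. h (T (insert i I) A)) =
     ?b * ?E (\<lambda>A. h (T I A + (1 - ?b) * ?y)) + (1 - ?b) * ?E (\<lambda>A. h (T I A + (- (?b * ?y))))"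
    for h :: "real \<Rightarrow> real"
  proof -
    have "?E (\<lambda>A. h (T (insert i I) (insert i A))) = ?E (\<lambda>A. h (T I A + (1 - ?b) * ?y))"
      by (intro subset_mean_cong) (simp add: T1)
    moreover have "?E (\<lambda>A. h (T (insert i I) A)) = ?E (\<lambda>A. h (T I A + (- (?b * ?y))))"
      by (simp only: T0)
    ultimately show ?thesis by (simp only: subset_mean_insert[OF insert.hyps(1,2)])
  qed
  note lin = subset_mean_add subset_mean_cmult subset_mean_const[OF insert.hyps(1)]
  have e1: "?E (\<lambda>A. T I A + c) = c" for c
    by (simp add: lin IH)
  have e2: "?E (\<lambda>A. (T I A + c)\<^sup>2) = v I + c\<^sup>2" for c
  proof -
    have "(\<lambda>A. (T I A + c)\<^sup>2) = (\<lambda>A. (T I A)\<^sup>2 + ((2*c) * T I A + c\<^sup>2))"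
      by (intro ext) (simp add: power2_eq_square algebra_simps)
    then show ?thesis by (simp add: lin IH)
  qed
  have e4: "?E (\<lambda>A. (T I A + c)^4) =
    ?E (\<lambda>A. (T I A)^4) + 4 * c * ?E (\<lambda>A. (T I A)^3) + 6 * c\<^sup>2 * v I + c^4" for c
  proof -
    have "(t + c)^4 = t^4 + ((4*c) * t^3 + ((6*c\<^sup>2) * t\<^sup>2 + ((4*c^3) * t + c^4)))" for t :: real
      by algebra
    then have "(\<lambda>A. (T I A + c)^4) = (\<lambda>A. (T I A)^4 + ((4*c) * (T I A)^3 + ((6*c\<^sup>2) * (T I A)\<^sup>2 + ((4*c^3) * T I A + c^4))))"
      by (intro ext)
    then show ?thesis by (simp add: lin IH)
  qed
  have 1: "subset_mean a (insert i I) (T (insert i I)) = 0"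
    using ins[of "\<lambda>x. x"] unfolding e1 by (simp add: algebra_simps)
  have "?b * (w + ((1 - ?b) * ?y)\<^sup>2) + (1 - ?b) * (w + (- (?b * ?y))\<^sup>2) = w + ?b * (1 - ?b) * ?y\<^sup>2" for w
    by algebra
  then have 2: "subset_mean a (insert i I) (\<lambda>A. (T (insert i I) A)\<^sup>2) = v (insert i I)"
    using ins[of "\<lambda>x. x\<^sup>2"] unfolding e2 v by simp
  have "?b * (E4 + 4 * ((1 - ?b) * ?y) * E3 + 6 * ((1 - ?b) * ?y)\<^sup>2 * w + ((1 - ?b) * ?y)^4)
      + (1 - ?b) * (E4 + 4 * (- (?b * ?y)) * E3 + 6 * (- (?b * ?y))\<^sup>2 * w + (- (?b * ?y))^4)
      = E4 + 6 * w * (?b * (1 - ?b) * ?y\<^sup>2) + (?b * (1-?b)^4 + (1-?b) * ?b^4) * ?y^4" for E4 E3 w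
    by algebra
  then have "subset_mean a (insert i I) (\<lambda>A. (T (insert i I) A)^4)
     = ?E (\<lambda>A. (T I A)^4) + 6 * v I * (?b * (1 - ?b) * ?y\<^sup>2)
       + (?b * (1-?b)^4 + (1-?b) * ?b^4) * ?y^4"
    using ins[of "\<lambda>x. x^4"] unfolding e4 by simp
  moreover have "(?b * (1-?b)^4 + (1-?b) * ?b^4) * ?y^4 \<le> (?b * (1 - ?b)) * ?y^4"
  proof -
    have "(1-?b)^3 \<le> (1-?b)^1" "?b^3 \<le> ?b^1" using b by (intro power_decreasing; simp)+
    then have "(1-?b)^3 + ?b^3 \<le> 1" by simp
    then have "(?b * (1 - ?b)) * ((1-?b)^3 + ?b^3) \<le> (?b * (1 - ?b)) * 1"
      using b by (intro mult_left_mono) auto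
    moreover have "?b * (1-?b)^4 + (1-?b) * ?b^4 = (?b * (1 - ?b)) * ((1-?b)^3 + ?b^3)"
      by (simp add: eval_nat_numeral algebra_simps)
    ultimately show ?thesis by (intro mult_right_mono) auto
  qed
  moreover have "?E (\<lambda>A. (T I A)^4) + 6 * v I * (?b * (1 - ?b) * ?y\<^sup>2) + (?b * (1 - ?b)) * ?y^4
    \<le> 3 * (v (insert i I))\<^sup>2 + (\<Sum>i\<in>insert i I. a i * (1 - a i) * (y i)^4)"
  proof -
    have "3 * (v (insert i I))\<^sup>2 = 3 * (v I)\<^sup>2 + 6 * v I * (?b * (1 - ?b) * ?y\<^sup>2) + 3 * (?b * (1 - ?b) * ?y\<^sup>2)\<^sup>2"
      unfolding v by (simp add: power2_eq_square algebra_simps)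
    moreover have "0 \<le> 3 * (?b * (1 - ?b) * ?y\<^sup>2)\<^sup>2" by simp
    moreover have "(\<Sum>i\<in>insert i I. a i * (1 - a i) * (y i)^4)
        = ?b * (1 - ?b) * ?y^4 + (\<Sum>i\<in>I. a i * (1 - a i) * (y i)^4)"
      using insert.hyps by simp
    moreover have "e \<le> 3 * w + s \<Longrightarrow> w' = 3 * w + 6 * q + r \<Longrightarrow> 0 \<le> r \<Longrightarrow> s' = u + s
        \<Longrightarrow> e + 6 * q + u \<le> w' + s'" for e w s w' q r s' u :: real
      by linarith
    ultimately show ?thesis using IH(3) by (simp only: mult.assoc)
  qed
  ultimately show ?case using 1 2 by linarith
qed

text \<open>
  The hypothesis bounds the kurtosis of the sum \<open>S\<close>, including its mean \<open>m\<close>: it yields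
  \<open>E S^4 \<le> 56 * (E S\<^sup>2)\<^sup>2\<close> with \<open>E S\<^sup>2 = m\<^sup>2 + v\<close>, and Paley-Zygmund turns this into the constant
  \<open>1 / (4 * 56)\<close>. Two cases matter: fair coins, where the left-hand side is at most \<open>4 * v\<^sup>2\<close>
  whatever the coefficients are, and selection with arbitrarily small probabilities, where
  coefficients that are small compared with the mean give the bound \<open>m\<^sup>2 * v\<close>.
\<close>
lemma subset_Paley_Zygmund:
  fixes y :: "'i \<Rightarrow> real"
  assumes fin: "finite I" and a: "\<And>i. i \<in> I \<Longrightarrow> 0 \<le> a i \<and> a i \<le> 1"
  defines "m \<equiv> \<Sum>i\<in>I. a i * y i"
  defines "v \<equiv> \<Sum>i\<in>I. a i * (1 - a i) * (y i)\<^sup>2"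
  assumes kurt: "(\<Sum>i\<in>I. a i * (1 - a i) * (y i)^4) \<le> 4 * v\<^sup>2 + m\<^sup>2 * v"
  shows "1 / 224 \<le> subset_mean a I (\<lambda>A. of_bool ((m\<^sup>2 + v) / 2 \<le> (\<Sum>i\<in>A. y i)\<^sup>2))"
proof -
  let ?E = "subset_mean a I"
  define S where "S = (\<lambda>A. \<Sum>i\<in>A. y i)"
  define T where "T = (\<lambda>A. S A - m)"
  define z where "z = m\<^sup>2 + v"
  have mom: "?E T = 0" "?E (\<lambda>A. (T A)\<^sup>2) = v"
    "?E (\<lambda>A. (T A)^4) \<le> 3 * v\<^sup>2 + (\<Sum>i\<in>I. a i * (1 - a i) * (y i)^4)"
    using subset_moments[OF fin a, where y=y] unfolding T_def S_def m_def v_def by auto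
  have v0: "0 \<le> v" unfolding v_def using a by (intro sum_nonneg) auto
  note lin = subset_mean_add subset_mean_cmult subset_mean_const[OF fin]
  have ES2: "?E (\<lambda>A. (S A)\<^sup>2) = z"
  proof -
    have "(\<lambda>A. (S A)\<^sup>2) = (\<lambda>A. (T A)\<^sup>2 + ((2*m) * T A + m\<^sup>2))"
      by (intro ext) (simp add: T_def power2_eq_square algebra_simps)
    then show ?thesis by (simp only: lin mom) (simp add: z_def)
  qed
  have ES4: "?E (\<lambda>A. (S A)^4) \<le> 56 * z\<^sup>2"
  proof -
    have "?E (\<lambda>A. (S A)^4) \<le> ?E (\<lambda>A. 8 * (T A)^4 + 8 * m^4)"
    proof (rule subset_mean_mono[OF a])
      fix A
      have "(T A + m)\<^sup>2 \<le> 2 * ((T A)\<^sup>2 + m\<^sup>2)"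
        using sum_squares_bound[of "T A" m] by (simp add: power2_eq_square algebra_simps)
      then have "((T A + m)\<^sup>2)\<^sup>2 \<le> (2 * ((T A)\<^sup>2 + m\<^sup>2))\<^sup>2" by (intro power_mono) auto
      also have "\<dots> \<le> 8 * (((T A)\<^sup>2)\<^sup>2 + (m\<^sup>2)\<^sup>2)"
        using sum_squares_bound[of "(T A)\<^sup>2" "m\<^sup>2"] by (simp add: power2_eq_square algebra_simps)
      finally show "(S A)^4 \<le> 8 * (T A)^4 + 8 * m^4" by (simp add: T_def)
    qed auto
    also have "\<dots> = 8 * ?E (\<lambda>A. (T A)^4) + 8 * m^4"
      by (simp only: lin)
    also have "\<dots> \<le> 8 * (7 * v\<^sup>2 + m\<^sup>2 * v) + 8 * m^4" using mom(3) kurt by simp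
    also have "\<dots> \<le> 8 * (7 * v\<^sup>2 + m\<^sup>2 * v) + 8 * m^4 + (104 * (m\<^sup>2 * v) + 48 * m^4)"
      using v0 by simp
    also have "\<dots> = 56 * z\<^sup>2" unfolding z_def by algebra
    finally show ?thesis .
  qed
  show ?thesis
  proof (cases "z = 0")
    case True
    have "(\<lambda>A. of_bool ((m\<^sup>2 + v) / 2 \<le> (\<Sum>i\<in>A. y i)\<^sup>2)) = (\<lambda>A. 1::real)"
      using True by (intro ext) (simp add: z_def)
    then show ?thesis by (simp add: subset_mean_const[OF fin])
  next
    case False
    then have z: "z > 0" using v0 by (simp add: z_def less_le)
    let ?I = "\<lambda>A. of_bool (z / 2 \<le> (S A)\<^sup>2) :: real"
    have "?E (\<lambda>A. (S A)\<^sup>2) \<le> ?E (\<lambda>A. z / 2 + ((1 / (224 * z)) * (S A)^4 + (56 * z) * ?I A))"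
    proof (rule subset_mean_mono[OF a])
      fix A
      let ?s = "(S A)\<^sup>2"
      show "?s \<le> z / 2 + ((1 / (224 * z)) * (S A)^4 + (56 * z) * ?I A)"
      proof (cases "z / 2 \<le> ?s")
        case True
        \<comment> \<open>the square root of \<open>E S^4 * P\<close> in Paley-Zygmund is replaced by an arithmetic mean, weighted for equality at \<open>(S A)\<^sup>2 = 112 * z\<close>\<close>
        define t where "t = 1 / (224 * z)"
        have t: "t * (224 * z) = 1" "0 \<le> t" using z by (auto simp: t_def)
        have "t * (?s - 112 * z)\<^sup>2 = t * (S A)^4 + 56 * z - ?s"
          using t(1) by algebra
        moreover have "0 \<le> t * (?s - 112 * z)\<^sup>2" using t(2) by simp
        ultimately have "?s \<le> t * (S A)^4 + 56 * z" by linarith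
        then show ?thesis using True z unfolding t_def by simp
      next
        case False
        moreover have "0 \<le> (1 / (224 * z)) * (S A)^4" using z by simp
        ultimately show ?thesis by simp
      qed
    qed auto
    also have "\<dots> = z / 2 + ((1 / (224 * z)) * ?E (\<lambda>A. (S A)^4) + (56 * z) * ?E ?I)"
      by (simp only: lin)
    also have "\<dots> \<le> z / 2 + (z / 4 + (56 * z) * ?E ?I)"
    proof -
      have "(1 / (224 * z)) * ?E (\<lambda>A. (S A)^4) \<le> (1 / (224 * z)) * (56 * z\<^sup>2)"
        using ES4 z by (intro mult_left_mono) auto
      also have "\<dots> = z / 4" using z by (simp add: power2_eq_square)
      finally show ?thesis by simp
    qed
    also have "\<dots> = z * (3 / 4 + 56 * ?E ?I)" by (simp add: distrib_left)
    finally have "z * 1 \<le> z * (3 / 4 + 56 * ?E ?I)" unfolding ES2 by simp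
    then have "1 \<le> 3 / 4 + 56 * ?E ?I" using z by (simp only: mult_le_cancel_left_pos)
    then show ?thesis by (simp add: S_def z_def)
  qed
qed

section \<open>Dyadic arrays of random variables\<close>

text \<open>
  Cell \<open>k\<close> of level \<open>n\<close> splits into the cells \<open>2 * k\<close> and \<open>2 * k + 1\<close> of level \<open>n + 1\<close>; these are the indices \<open>i\<close>
  levels below a cell of \<open>J\<close>.
\<close>
definition descendants :: "nat \<Rightarrow> nat set \<Rightarrow> nat set" where
  "descendants i J = (\<lambda>k. k div 2 ^ i) -` J"

lemma descendants_0 [simp]: "descendants 0 J = J"
  by (simp add: descendants_def)

lemma descendants_mono: "J \<subseteq> J' \<Longrightarrow> descendants i J \<subseteq> descendants i J'"
  by (auto simp: descendants_def)

lemma descendants_add: "descendants j (descendants i J) = descendants (i + j) J"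
  by (auto simp: descendants_def power_add div_mult2_eq mult.commute[of "2 ^ i"])

lemma descendants_bounded:
  assumes "J \<subseteq> {..<2 ^ n}" shows "descendants i J \<subseteq> {..<2 ^ (n + i)}"
proof
  fix k assume "k \<in> descendants i J"
  then have "k div 2 ^ i < 2 ^ n" using assms by (auto simp: descendants_def)
  then show "k \<in> {..<2 ^ (n + i)}"
    by (simp add: power_add div_less_iff_less_mult)
qed

lemma finite_bounded: "J \<subseteq> {..<2 ^ n :: nat} \<Longrightarrow> finite J"
  using finite_subset by blast

lemma finite_descendants: "finite J \<Longrightarrow> finite (descendants i J)"
proof -
  assume "finite J"
  then obtain n where "J \<subseteq> {..<n}" using finite_nat_bounded by blast
  also have "\<dots> \<subseteq> {..<2 ^ n}" using less_exp[of n] by (auto intro: less_trans)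
  finally have "J \<subseteq> {..<2 ^ n}" .
  from finite_bounded[OF descendants_bounded[OF this]] show ?thesis .
qed

lemma sum_children:
  fixes F :: "nat \<Rightarrow> real"
  assumes "finite J"
  shows "(\<Sum>k\<in>descendants 1 J. F k) = (\<Sum>k\<in>J. F (2 * k) + F (2 * k + 1))"
proof -
  have "descendants 1 J = (\<lambda>k. 2 * k) ` J \<union> (\<lambda>k. 2 * k + 1) ` J"
  proof (intro equalityI subsetI)
    fix k assume "k \<in> descendants 1 J"
    then have "k div 2 \<in> J" by (simp add: descendants_def)
    moreover have "k = 2 * (k div 2) \<or> k = 2 * (k div 2) + 1" by linarith
    ultimately show "k \<in> (\<lambda>k. 2 * k) ` J \<union> (\<lambda>k. 2 * k + 1) ` J" by blast
  qed (auto simp: descendants_def)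
  moreover have "(\<lambda>k. 2 * k) ` J \<inter> (\<lambda>k. 2 * k + 1) ` J = {}"
    by auto presburger
  ultimately have "(\<Sum>k\<in>descendants 1 J. F k)
      = (\<Sum>k\<in>(\<lambda>k. 2 * k) ` J. F k) + (\<Sum>k\<in>(\<lambda>k. 2 * k + 1) ` J. F k)"
    using assms by (simp add: sum.union_disjoint)
  also have "\<dots> = (\<Sum>k\<in>J. F (2 * k)) + (\<Sum>k\<in>J. F (2 * k + 1))"
    by (simp add: sum.reindex inj_on_def)
  finally show ?thesis by (simp add: sum.distrib)
qed

text \<open>
  An abstract additive process on the dyadic cells. The assumption \<open>exhaustive\<close> is the shadow of \<open>\<sigma>\<close>-additivity:
  \<open>B j\<close> is a set of cells of level \<open>L j\<close>, and the sets of cells are pairwise disjoint as subsets of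
  the interval. The assumption \<open>x_small\<close> is the shadow of path continuity.
\<close>
locale dyadic_array = prob_space M for M :: "'w measure" +
  fixes x :: "nat \<Rightarrow> nat \<Rightarrow> 'w \<Rightarrow> real" and w :: "nat \<Rightarrow> real"
  assumes x_measurable: "\<And>n k. k < 2 ^ n \<Longrightarrow> x n k \<in> borel_measurable M"
    and x_split: "\<And>n k \<omega>. \<omega> \<in> space M \<Longrightarrow> k < 2 ^ n \<Longrightarrow>
        x n k \<omega> = x (Suc n) (2 * k) \<omega> + x (Suc n) (2 * k + 1) \<omega>"
    and x_small: "\<And>\<omega>. \<omega> \<in> space M \<Longrightarrow> \<forall>\<^sub>F n in sequentially. \<forall>k<2 ^ n. \<bar>x n k \<omega>\<bar> \<le> 1"
    and exhaustive: "\<And>L B. (\<And>j. B j \<subseteq> {..<2 ^ L j}) \<Longrightarrow>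
        (\<And>i j. i < j \<Longrightarrow> L i \<le> L j \<and> descendants (L j - L i) (B i) \<inter> B j = {}) \<Longrightarrow>
        (\<lambda>j. prob {\<omega> \<in> space M. 1 < \<bar>\<Sum>k\<in>B j. x (L j) k \<omega>\<bar>}) \<longlonglongrightarrow> 0"
    and w_nonneg: "\<And>n. 0 \<le> w n"
    and w_sum: "\<And>N. (\<Sum>n<N. w n) \<le> 1"
begin

lemma w_sum_from: "(\<Sum>i<N. w (n + i)) \<le> 1"
proof -
  have "(\<Sum>i<N. w (n + i)) = sum w {n..<n + N}"
    by (simp add: sum.shift_bounds_nat_ivl[of w 0 n N, simplified] atLeast0LessThan add.commute)
  also have "\<dots> \<le> sum w {..<n + N}" using w_nonneg by (intro sum_mono2) auto
  finally show ?thesis using w_sum[of "n + N"] by linarith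
qed

lemma sum_refine:
  assumes J: "J \<subseteq> {..<2 ^ n}" and \<omega>: "\<omega> \<in> space M"
  shows "(\<Sum>k\<in>J. g k * x n k \<omega>) = (\<Sum>k\<in>descendants i J. g (k div 2 ^ i) * x (n + i) k \<omega>)"
proof (induction i)
  case (Suc i)
  let ?J = "descendants i J"
  have b: "?J \<subseteq> {..<2 ^ (n + i)}" by (rule descendants_bounded[OF J])
  have "(\<Sum>k\<in>descendants (Suc i) J. g (k div 2 ^ Suc i) * x (n + Suc i) k \<omega>)
     = (\<Sum>k\<in>descendants 1 ?J. g (k div 2 div 2 ^ i) * x (Suc (n + i)) k \<omega>)"
    by (simp add: descendants_add div_mult2_eq)
  also have "\<dots> = (\<Sum>k\<in>?J. g (2 * k div 2 div 2 ^ i) * x (Suc (n + i)) (2 * k) \<omega>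
      + g ((2 * k + 1) div 2 div 2 ^ i) * x (Suc (n + i)) (2 * k + 1) \<omega>)"
    by (rule sum_children[OF finite_bounded[OF b]])
  also have "\<dots> = (\<Sum>k\<in>?J. g (k div 2 ^ i) * x (n + i) k \<omega>)"
  proof (rule sum.cong[OF refl])
    fix k assume "k \<in> ?J"
    then have "k < 2 ^ (n + i)" using b by auto
    from x_split[OF \<omega> this]
    show "g (2 * k div 2 div 2 ^ i) * x (Suc (n + i)) (2 * k) \<omega> +
        g ((2 * k + 1) div 2 div 2 ^ i) * x (Suc (n + i)) (2 * k + 1) \<omega> = g (k div 2 ^ i) * x (n + i) k \<omega>"
      by (simp add: distrib_left)
  qed
  finally show ?case using Suc by simp
qed simp

text \<open>
  The weighted square sum over all cells inside \<open>J\<close>. It takes extended values so that the event of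
  infinite energy is subadditive in \<open>J\<close>: an infinite energy is infinite in one of the finitely many cells.
\<close>
definition energy :: "nat \<Rightarrow> nat set \<Rightarrow> 'w \<Rightarrow> ennreal" where
  "energy n J \<omega> = (\<Sum>i. ennreal ((w (n + i))\<^sup>2 * (\<Sum>k\<in>descendants i J. (x (n + i) k \<omega>)\<^sup>2)))"

definition bad :: "nat \<Rightarrow> nat set \<Rightarrow> 'w set" where
  "bad n J = {\<omega> \<in> space M. energy n J \<omega> = \<infinity>}"

lemma x_measurable': "J \<subseteq> {..<2 ^ n} \<Longrightarrow> k \<in> J \<Longrightarrow> x n k \<in> borel_measurable M"
  using x_measurable by blast

lemma bad_sets [measurable]:
  assumes "J \<subseteq> {..<2 ^ n}" shows "bad n J \<in> events"
proof -
  have [measurable]: "x (n + i) k \<in> borel_measurable M" if "k \<in> descendants i J" for i k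
    using x_measurable'[OF descendants_bounded[OF assms] that] .
  show ?thesis unfolding bad_def energy_def by measurable
qed

lemma energy_mono:
  assumes "J \<subseteq> J'" "finite J'" shows "energy n J \<omega> \<le> energy n J' \<omega>"
  unfolding energy_def
  by (intro suminf_le summableI ennreal_leI mult_left_mono sum_mono2)
    (use assms descendants_mono finite_descendants in auto)

lemma energy_infinite_cell:
  assumes fin: "finite J" and inf: "energy n J \<omega> = \<infinity>"
  obtains k where "k \<in> J" "energy n {k} \<omega> = \<infinity>"
proof -
  let ?t = "\<lambda>i k. (x (n + i) k \<omega>)\<^sup>2"
  have "ennreal ((w (n + i))\<^sup>2 * (\<Sum>k\<in>descendants i J. ?t i k))
      = (\<Sum>k\<in>J. ennreal ((w (n + i))\<^sup>2 * (\<Sum>k'\<in>descendants i {k}. ?t i k')))" for i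
  proof -
    have "(\<Sum>k\<in>J. sum (?t i) {k' \<in> descendants i J. k' div 2 ^ i = k}) = sum (?t i) (descendants i J)"
      by (rule sum.group) (use fin finite_descendants in \<open>auto simp: descendants_def\<close>)
    moreover have "{k' \<in> descendants i J. k' div 2 ^ i = k} = descendants i {k}" if "k \<in> J" for k
      using that by (auto simp: descendants_def)
    ultimately have "sum (?t i) (descendants i J) = (\<Sum>k\<in>J. sum (?t i) (descendants i {k}))"
      by simp
    then show ?thesis
      by (simp add: sum_distrib_left sum_ennreal sum_nonneg)
  qed
  then have "energy n J \<omega> = (\<Sum>k\<in>J. energy n {k} \<omega>)"
    unfolding energy_def by (simp add: suminf_sum)
  with inf have "(\<Sum>k\<in>J. energy n {k} \<omega>) = top" by simp
  then have "\<exists>k\<in>J. energy n {k} \<omega> = top" using fin by simp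
  then show ?thesis using that by auto
qed

text \<open>Passing to a finer level drops finitely many terms of the series, all of them finite.\<close>
lemma energy_infinite_refine:
  assumes "energy n J \<omega> = \<infinity>" shows "energy (n + i) (descendants i J) \<omega> = \<infinity>"
proof -
  let ?f = "\<lambda>j. ennreal ((w (n + j))\<^sup>2 * (\<Sum>k\<in>descendants j J. (x (n + j) k \<omega>)\<^sup>2))"
  have "suminf ?f = (\<Sum>j. ?f (j + i)) + sum ?f {..<i}"
    by (rule suminf_offset) simp
  moreover have "sum ?f {..<i} < \<infinity>" by auto
  moreover have "(\<Sum>j. ?f (j + i)) = energy (n + i) (descendants i J) \<omega>"
    unfolding energy_def by (simp add: descendants_add add_ac)
  ultimately have "energy (n + i) (descendants i J) \<omega> + sum ?f {..<i} = top" "sum ?f {..<i} < top"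
    using assms unfolding energy_def by simp_all
  then show ?thesis by auto
qed

text \<open>
  Fubini for the product of the finite selection space with \<open>M\<close>. The next lemmas use it to
  turn a bound that holds for each outcome \<open>\<omega>\<close> separately into one on probabilities.
\<close>
lemma subset_mean_prob:
  assumes "F \<in> events" "\<And>A. A \<subseteq> I \<Longrightarrow> E A \<in> events"
  shows "subset_mean a I (\<lambda>A. prob (F \<inter> E A))
    = (\<integral>\<omega>. indicator F \<omega> * subset_mean a I (\<lambda>A. of_bool (\<omega> \<in> E A)) \<partial>M)"
proof -
  have "subset_mean a I (\<lambda>A. prob (F \<inter> E A))
     = (\<Sum>A\<in>Pow I. (\<integral>\<omega>. subset_weight a I A * indicator (F \<inter> E A) \<omega> \<partial>M))"
    unfolding subset_mean_def using assms by (intro sum.cong refl) auto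
  also have "\<dots> = (\<integral>\<omega>. (\<Sum>A\<in>Pow I. subset_weight a I A * indicator (F \<inter> E A) \<omega>) \<partial>M)"
    using assms by (intro Bochner_Integration.integral_sum[symmetric] integrable_mult_right
      integrable_real_indicator) (auto simp: emeasure_eq_measure)
  also have "\<dots> = (\<integral>\<omega>. indicator F \<omega> * subset_mean a I (\<lambda>A. of_bool (\<omega> \<in> E A)) \<partial>M)"
    by (intro Bochner_Integration.integral_cong refl)
      (auto simp: subset_mean_def indicator_def sum_distrib_left intro!: sum.cong)
  finally show ?thesis .
qed

lemma subset_mean_prob_integrable:
  assumes "F \<in> events" "\<And>A. A \<subseteq> I \<Longrightarrow> E A \<in> events"
  shows "integrable M (\<lambda>\<omega>. indicator F \<omega> * subset_mean a I (\<lambda>A. of_bool (\<omega> \<in> E A)))"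
proof -
  have "integrable M (\<lambda>\<omega>. \<Sum>A\<in>Pow I. subset_weight a I A * indicator (F \<inter> E A) \<omega>)"
    using assms by (intro Bochner_Integration.integrable_sum integrable_mult_right
      integrable_real_indicator) (auto simp: emeasure_eq_measure)
  also have "(\<lambda>\<omega>. \<Sum>A\<in>Pow I. subset_weight a I A * indicator (F \<inter> E A) \<omega>)
    = (\<lambda>\<omega>. indicator F \<omega> * subset_mean a I (\<lambda>A. of_bool (\<omega> \<in> E A)))"
    by (intro ext) (auto simp: subset_mean_def indicator_def sum_distrib_left intro!: sum.cong)
  finally show ?thesis .
qed

lemma subset_mean_prob_ge:
  assumes F: "F \<in> events" and E: "\<And>A. A \<subseteq> I \<Longrightarrow> E A \<in> events"
    and c: "\<And>\<omega>. \<omega> \<in> F \<Longrightarrow> c \<le> subset_mean a I (\<lambda>A. of_bool (\<omega> \<in> E A))"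
  shows "c * prob F \<le> subset_mean a I (\<lambda>A. prob (F \<inter> E A))"
proof -
  have "c * prob F = (\<integral>\<omega>. c * indicator F \<omega> \<partial>M)" using F by simp
  also have "\<dots> \<le> (\<integral>\<omega>. indicator F \<omega> * subset_mean a I (\<lambda>A. of_bool (\<omega> \<in> E A)) \<partial>M)"
    using F E c by (intro integral_mono subset_mean_prob_integrable integrable_mult_right
      integrable_real_indicator) (auto simp: indicator_def emeasure_eq_measure)
  finally show ?thesis by (simp only: subset_mean_prob[OF F E])
qed

lemma subset_mean_prob_le:
  assumes F: "F \<in> events" and E: "\<And>A. A \<subseteq> I \<Longrightarrow> E A \<in> events"
    and c: "\<And>\<omega>. \<omega> \<in> F \<Longrightarrow> subset_mean a I (\<lambda>A. of_bool (\<omega> \<in> E A)) \<le> c"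
  shows "subset_mean a I (\<lambda>A. prob (F \<inter> E A)) \<le> c * prob F"
proof -
  have "(\<integral>\<omega>. indicator F \<omega> * subset_mean a I (\<lambda>A. of_bool (\<omega> \<in> E A)) \<partial>M) \<le> (\<integral>\<omega>. c * indicator F \<omega> \<partial>M)"
    using F E c by (intro integral_mono subset_mean_prob_integrable integrable_mult_right
      integrable_real_indicator) (auto simp: indicator_def emeasure_eq_measure)
  also have "\<dots> = c * prob F" using F by simp
  finally show ?thesis by (simp only: subset_mean_prob[OF F E])
qed

text \<open>
  The fair coins are indexed by the cells of several levels at once. This is needed because the level at which the
  square sum is large depends on \<open>\<omega>\<close>, so no single level would do. The variance of the random
  sum is a quarter of the truncated energy, and the truncation is chosen so late that the latter
  exceeds \<open>8 * C\<close> on half of the bad event; together with the Paley-Zygmund constant this explains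
  the factor \<open>1 / (2 * 224)\<close>.
\<close>
lemma random_signs:
  assumes R: "R \<subseteq> {..<2 ^ n}" and pos: "0 < prob (bad n R)"
  obtains N A where "A \<subseteq> Sigma {..<N} (\<lambda>i. descendants i R)"
    and "prob (bad n R) / 448 \<le>
      prob {\<omega> \<in> space M. C \<le> (\<Sum>(i, k)\<in>A. w (n + i) * x (n + i) k \<omega>)\<^sup>2}"
proof -
  define q where "q N \<omega> = (\<Sum>i<N. (w (n + i))\<^sup>2 * (\<Sum>k\<in>descendants i R. (x (n + i) k \<omega>)\<^sup>2))" for N \<omega>
  define F where "F N = {\<omega> \<in> bad n R. 8 * C \<le> q N \<omega>}" for N
  have xm [measurable]: "x (n + i) k \<in> borel_measurable M" if "k \<in> descendants i R" for i k
    using x_measurable'[OF descendants_bounded[OF R] that] .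
  have [measurable]: "bad n R \<in> events" using bad_sets[OF R] .
  have [measurable]: "q N \<in> borel_measurable M" for N
    unfolding q_def by measurable
  have F: "F N \<in> events" for N
  proof -
    have "F N = bad n R \<inter> {\<omega> \<in> space M. 8 * C \<le> q N \<omega>}"
      by (auto simp: F_def bad_def)
    then show ?thesis by simp
  qed
  have q_mono: "q N \<omega> \<le> q N' \<omega>" if "N \<le> N'" for N N' \<omega>
    unfolding q_def using that by (intro sum_mono2) (auto intro!: mult_nonneg_nonneg sum_nonneg)
  have "incseq F"
    unfolding incseq_def F_def by (auto intro: order_trans[OF _ q_mono])
  moreover have "(\<Union>N. F N) = bad n R"
  proof (intro equalityI subsetI)
    fix \<omega> assume \<omega>: "\<omega> \<in> bad n R"
    show "\<omega> \<in> (\<Union>N. F N)"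
    proof (rule ccontr)
      assume "\<omega> \<notin> (\<Union>N. F N)"
      then have less: "q N \<omega> \<le> 8 * C" for N using \<omega> by (auto simp: F_def not_le intro: less_imp_le)
      let ?f = "\<lambda>i. (w (n + i))\<^sup>2 * (\<Sum>k\<in>descendants i R. (x (n + i) k \<omega>)\<^sup>2)"
      have nn: "0 \<le> ?f i" for i by (intro mult_nonneg_nonneg sum_nonneg) auto
      have "summable ?f"
        by (rule summableI_nonneg_bounded[of _ "8 * C"]) (use less nn in \<open>auto simp: q_def\<close>)
      then have "energy n R \<omega> \<noteq> top"
        unfolding energy_def by (intro ennreal_suminf_neq_top nn)
      then show False using \<omega> by (simp add: bad_def)
    qed
  qed (auto simp: F_def)
  ultimately have "(\<lambda>N. prob (F N)) \<longlonglongrightarrow> prob (bad n R)"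
    using finite_Lim_measure_incseq[of F] F by auto
  then have "\<forall>\<^sub>F N in sequentially. prob (bad n R) / 2 < prob (F N)"
    by (rule order_tendstoD) (use pos in simp)
  then obtain N where N: "prob (bad n R) / 2 < prob (F N)"
    by (auto simp: eventually_sequentially)
  define I where "I = Sigma {..<N} (\<lambda>i. descendants i R)"
  define y where "y \<omega> = (\<lambda>(i, k). w (n + i) * x (n + i) k \<omega>)" for \<omega>
  have finI: "finite I"
    unfolding I_def using finite_descendants[OF finite_bounded[OF R]] by (intro finite_SigmaI) auto
  have ym [measurable]: "(\<lambda>\<omega>. y \<omega> j) \<in> borel_measurable M" if "j \<in> I" for j
  proof -
    obtain i k where j: "j = (i, k)" "k \<in> descendants i R" using \<open>j \<in> I\<close> by (auto simp: I_def)
    show ?thesis unfolding j(1) y_def using xm[OF j(2)] by simp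
  qed
  define E where "E A = {\<omega> \<in> space M. C \<le> (\<Sum>j\<in>A. y \<omega> j)\<^sup>2}" for A
  have E: "E A \<in> events" if "A \<subseteq> I" for A
  proof -
    have [measurable]: "(\<lambda>\<omega>. y \<omega> j) \<in> borel_measurable M" if "j \<in> A" for j
      using ym that \<open>A \<subseteq> I\<close> by auto
    show ?thesis unfolding E_def by measurable
  qed
  have "1 / 224 * prob (F N) \<le> subset_mean (\<lambda>_. 1 / 2) I (\<lambda>A. prob (F N \<inter> E A))"
  proof (rule subset_mean_prob_ge[OF F E])
    fix \<omega> assume \<omega>: "\<omega> \<in> F N"
    let ?m = "\<Sum>j\<in>I. 1 / 2 * y \<omega> j" and ?v = "\<Sum>j\<in>I. 1 / 2 * (1 - 1 / 2) * (y \<omega> j)\<^sup>2"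
    have q: "q N \<omega> = (\<Sum>j\<in>I. (y \<omega> j)\<^sup>2)"
    proof -
      have "q N \<omega> = (\<Sum>i<N. \<Sum>k\<in>descendants i R. (y \<omega> (i, k))\<^sup>2)"
        by (simp add: q_def y_def sum_distrib_left power_mult_distrib)
      also have "\<dots> = (\<Sum>(i, k)\<in>I. (y \<omega> (i, k))\<^sup>2)"
        unfolding I_def by (rule sum.Sigma) (auto simp: finite_descendants[OF finite_bounded[OF R]])
      finally show ?thesis by (simp add: case_prod_unfold)
    qed
    have v: "4 * ?v = q N \<omega>" unfolding q by (simp add: sum_distrib_left)
    have "(\<Sum>j\<in>I. 1 / 2 * (1 - 1 / 2) * (y \<omega> j)^4) \<le> 4 * ?v\<^sup>2"
    proof -
      have "(\<Sum>j\<in>I. (y \<omega> j)^4) \<le> (\<Sum>j\<in>I. (y \<omega> j)\<^sup>2 * q N \<omega>)"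
      proof (rule sum_mono)
        fix j assume "j \<in> I"
        then have "(y \<omega> j)\<^sup>2 \<le> q N \<omega>" unfolding q by (intro member_le_sum) (auto simp: finI)
        then have "(y \<omega> j)\<^sup>2 * (y \<omega> j)\<^sup>2 \<le> (y \<omega> j)\<^sup>2 * q N \<omega>" by (intro mult_left_mono) auto
        then show "(y \<omega> j)^4 \<le> (y \<omega> j)\<^sup>2 * q N \<omega>" by (simp flip: power_add)
      qed
      also have "\<dots> = (q N \<omega>)\<^sup>2" by (simp add: q power2_eq_square sum_distrib_right)
      also have "\<dots> = 16 * ?v\<^sup>2" unfolding v[symmetric] by (simp add: power_mult_distrib)
      finally show ?thesis by (simp flip: sum_divide_distrib)
    qed
    also have "\<dots> \<le> 4 * ?v\<^sup>2 + ?m\<^sup>2 * ?v"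
      by (simp add: sum_nonneg)
    finally have "1 / 224 \<le> subset_mean (\<lambda>_. 1 / 2) I (\<lambda>A. of_bool ((?m\<^sup>2 + ?v) / 2 \<le> (\<Sum>j\<in>A. y \<omega> j)\<^sup>2))"
      by (intro subset_Paley_Zygmund finI) auto
    also have "\<dots> \<le> subset_mean (\<lambda>_. 1 / 2) I (\<lambda>A. of_bool (\<omega> \<in> E A))"
    proof (rule subset_mean_mono)
      fix A
      have "\<omega> \<in> space M" using \<omega> by (simp add: F_def bad_def)
      moreover have "C \<le> (?m\<^sup>2 + ?v) / 2"
      proof -
        have "2 * C \<le> ?v" using \<omega> v by (simp add: F_def)
        then have "2 * C \<le> ?m\<^sup>2 + ?v" by (intro add_increasing) auto
        moreover have "C \<le> z / 2" if "2 * C \<le> z" for z :: real using that by simp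
        ultimately show ?thesis by blast
      qed
      ultimately show "of_bool ((?m\<^sup>2 + ?v) / 2 \<le> (\<Sum>j\<in>A. y \<omega> j)\<^sup>2) \<le> (of_bool (\<omega> \<in> E A) :: real)"
        by (auto simp: E_def)
    qed auto
    finally show "1 / 224 \<le> subset_mean (\<lambda>_. 1 / 2) I (\<lambda>A. of_bool (\<omega> \<in> E A))" .
  qed auto
  then obtain A where A: "A \<subseteq> I" "1 / 224 * prob (F N) \<le> prob (F N \<inter> E A)"
    by (rule subset_mean_attained[OF _ finI, of "\<lambda>_. 1 / 2", rotated]) auto
  have "prob (bad n R) / 448 \<le> 1 / 224 * prob (F N)" using N by simp
  also note A(2)
  also have "prob (F N \<inter> E A) \<le> prob (E A)" using E[OF A(1)] by (intro finite_measure_mono) auto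
  finally show thesis using that[of A N] A(1) by (simp add: I_def E_def y_def case_prod_unfold)
qed

text \<open>
  The induction step. The linear combination from \<open>random_signs\<close> is the integral of a function
  with values in \<open>[0, 1]\<close>; \<open>\<theta>\<close> times this function serves as the selection probability of the fine
  cells, so that the sum over a random set \<open>B\<close> has \<open>\<theta>\<close> times that combination as its mean. The
  gain \<open>\<beta> * \<pi>\<close> does not depend on \<open>\<theta>\<close>, while the loss of infinite energy is at most \<open>\<theta> * \<pi>\<close>, where \<open>\<pi>\<close> is the probability of
  the bad event. Averaging the gain minus \<open>1 / \<tau>\<close> times the loss gives one \<open>B\<close> that is good for both.
\<close>
lemma thinning:
  assumes R: "R \<subseteq> {..<2 ^ n}" and pos: "0 < prob (bad n R)" and \<tau>: "0 < \<tau>" "\<tau> \<le> 1"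
  obtains i B where "B \<subseteq> descendants i R"
    and "prob (bad n R) / (8 * 224\<^sup>2) \<le> prob {\<omega> \<in> space M. 1 < \<bar>\<Sum>k\<in>B. x (n + i) k \<omega>\<bar>}"
    and "prob (bad n R) - \<tau> \<le> prob (bad (n + i) (descendants i R - B))"
proof -
  define \<pi> where "\<pi> = prob (bad n R)"
  \<comment> \<open>two uses of the constant \<open>1 / 224\<close>, and a factor \<open>1 / 2\<close> each for the truncation in \<open>random_signs\<close>, for
    the event \<open>H K\<close>, and for the compensation of the loss\<close>
  define \<beta> :: real where "\<beta> = 1 / (8 * 224\<^sup>2)"
  define \<theta> where "\<theta> = \<beta> * \<tau>"
  have \<beta>: "0 < \<beta>" "\<beta> \<le> 1" by (auto simp: \<beta>_def)
  have \<theta>: "0 < \<theta>" "\<theta> \<le> 1" using \<beta> \<tau> by (auto simp: \<theta>_def mult_le_one)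
  obtain N A where A: "A \<subseteq> Sigma {..<N} (\<lambda>i. descendants i R)"
    and PA: "\<pi> / 448 \<le> prob {\<omega> \<in> space M. (2 / \<theta>)\<^sup>2 \<le> (\<Sum>(i, k)\<in>A. w (n + i) * x (n + i) k \<omega>)\<^sup>2}"
    unfolding \<pi>_def by (rule random_signs[OF R pos])
  define S where "S \<omega> = (\<Sum>(i, k)\<in>A. w (n + i) * x (n + i) k \<omega>)" for \<omega>
  define E1 where "E1 = {\<omega> \<in> space M. (2 / \<theta>)\<^sup>2 \<le> (S \<omega>)\<^sup>2}"
  have xm [measurable]: "x (n + i) k \<in> borel_measurable M" if "k \<in> descendants i R" for i k
    using x_measurable'[OF descendants_bounded[OF R] that] .
  have finR: "finite (descendants i R)" for i
    using finite_descendants[OF finite_bounded[OF R]] .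
  have [measurable]: "S \<in> borel_measurable M"
  proof -
    have "(\<lambda>\<omega>. case j of (i, k) \<Rightarrow> w (n + i) * x (n + i) k \<omega>) \<in> borel_measurable M" if jA: "j \<in> A" for j
    proof -
      obtain i k where j: "j = (i, k)" "k \<in> descendants i R" using jA A by (cases j) auto
      show ?thesis unfolding j(1) using xm[OF j(2)] by simp
    qed
    then show ?thesis unfolding S_def by (rule borel_measurable_sum)
  qed
  have [measurable]: "E1 \<in> events" unfolding E1_def by measurable
  define H where "H K = {\<omega> \<in> space M. \<forall>i\<ge>K. \<forall>k<2 ^ (n + i). \<bar>x (n + i) k \<omega>\<bar> \<le> 1}" for K
  have H_sets [measurable]: "H K \<in> events" for K
  proof -
    have 1: "{\<omega> \<in> space M. \<bar>x (n + i) k \<omega>\<bar> \<le> 1} \<in> events" if "k \<in> {..<2 ^ (n + i)}" for i k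
    proof -
      have [measurable]: "x (n + i) k \<in> borel_measurable M" using that by (intro x_measurable) simp
      show ?thesis by measurable
    qed
    have 2: "{\<omega> \<in> space M. K \<le> i \<longrightarrow> (\<forall>k\<in>{..<2 ^ (n + i)}. \<bar>x (n + i) k \<omega>\<bar> \<le> 1)} \<in> events" for i
    proof (cases "K \<le> i")
      case True
      have "{\<omega> \<in> space M. \<forall>k\<in>{..<2 ^ (n + i)}. \<bar>x (n + i) k \<omega>\<bar> \<le> 1} \<in> events"
        by (rule sets.sets_Collect_finite_All[OF 1]) auto
      then show ?thesis using True by simp
    qed simp
    have "H K = {\<omega> \<in> space M. \<forall>i. K \<le> i \<longrightarrow> (\<forall>k\<in>{..<2 ^ (n + i)}. \<bar>x (n + i) k \<omega>\<bar> \<le> 1)}"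
      by (auto simp: H_def)
    also have "\<dots> \<in> events" by (rule sets.sets_Collect_countable_All[OF 2])
    finally show ?thesis .
  qed
  have "incseq H" unfolding incseq_def H_def by auto
  moreover have "(\<Union>K. H K) = space M"
  proof (intro equalityI subsetI)
    fix \<omega> assume \<omega>: "\<omega> \<in> space M"
    then obtain K where "\<And>i. i \<ge> K \<Longrightarrow> \<forall>k<2 ^ i. \<bar>x i k \<omega>\<bar> \<le> 1"
      using x_small[OF \<omega>] by (auto simp: eventually_sequentially)
    then have "\<omega> \<in> H K" using \<omega> by (simp add: H_def)
    then show "\<omega> \<in> (\<Union>K. H K)" by blast
  qed (auto simp: H_def)
  moreover have "range H \<subseteq> events" using H_sets by auto
  ultimately have "(\<lambda>K. prob (H K)) \<longlonglongrightarrow> 1"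
    using finite_Lim_measure_incseq[of H] prob_space by auto
  then have "\<forall>\<^sub>F K in sequentially. 1 - \<pi> / 896 < prob (H K)"
    by (rule order_tendstoD) (use pos in \<open>simp add: \<pi>_def\<close>)
  then have "\<forall>\<^sub>F K in sequentially. 1 - \<pi> / 896 < prob (H K) \<and> N \<le> K"
    using eventually_ge_at_top by (rule eventually_conj)
  then obtain K where K: "1 - \<pi> / 896 < prob (H K)" "N \<le> K"
    by (auto simp: eventually_sequentially)
  define F where "F = E1 \<inter> H K"
  have [measurable]: "F \<in> events" unfolding F_def by measurable
  have PF: "\<pi> / 896 \<le> prob F"
  proof -
    have "prob E1 \<le> prob (F \<union> (space M - H K))"
      by (intro finite_measure_mono) (auto simp: F_def E1_def)
    also have "\<dots> \<le> prob F + prob (space M - H K)" by (intro measure_Un_le) auto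
    finally show ?thesis using PA K(1) prob_compl[of "H K"] by (simp add: E1_def S_def)
  qed
  \<comment> \<open>\<open>c\<close> is the linear combination of \<open>random_signs\<close>, rewritten in terms of the cells of level \<open>n + K\<close>\<close>
  define I where "I = descendants K R"
  have finI: "finite I" unfolding I_def by (rule finR)
  define c where "c k = (\<Sum>i<N. w (n + i) * of_bool ((i, k div 2 ^ (K - i)) \<in> A))" for k
  define a where "a k = \<theta> * c k" for k
  have a: "0 \<le> a k" "a k \<le> \<theta>" for k
  proof -
    show "0 \<le> a k" unfolding a_def c_def using \<theta> w_nonneg by (intro mult_nonneg_nonneg sum_nonneg) auto
    have "c k \<le> (\<Sum>i<N. w (n + i))"
      unfolding c_def using w_nonneg by (intro sum_mono) auto
    also have "\<dots> \<le> 1" by (rule w_sum_from)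
    finally show "a k \<le> \<theta>" unfolding a_def using \<theta> by (intro mult_left_le) auto
  qed
  have a1: "0 \<le> a k \<and> a k \<le> 1" for k using a[of k] \<theta> by auto
  have mean: "(\<Sum>k\<in>I. a k * x (n + K) k \<omega>) = \<theta> * S \<omega>" if \<omega>: "\<omega> \<in> space M" for \<omega>
  proof -
    have "S \<omega> = (\<Sum>(i, k)\<in>Sigma {..<N} (\<lambda>i. descendants i R). (w (n + i) * of_bool ((i, k) \<in> A)) * x (n + i) k \<omega>)"
      unfolding S_def using A finR
      by (intro sum.mono_neutral_cong_left finite_SigmaI) auto
    also have "\<dots> = (\<Sum>i<N. \<Sum>k\<in>descendants i R. (w (n + i) * of_bool ((i, k) \<in> A)) * x (n + i) k \<omega>)"
      using finR by (intro sum.Sigma[symmetric]) auto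
    also have "\<dots> = (\<Sum>i<N. \<Sum>k\<in>I. (w (n + i) * of_bool ((i, k div 2 ^ (K - i)) \<in> A)) * x (n + K) k \<omega>)"
    proof (rule sum.cong[OF refl])
      fix i assume "i \<in> {..<N}"
      then have iK: "i \<le> K" using K(2) by simp
      then have *: "descendants (K - i) (descendants i R) = I" "n + i + (K - i) = n + K"
        by (auto simp: descendants_add I_def)
      show "(\<Sum>k\<in>descendants i R. (w (n + i) * of_bool ((i, k) \<in> A)) * x (n + i) k \<omega>)
        = (\<Sum>k\<in>I. (w (n + i) * of_bool ((i, k div 2 ^ (K - i)) \<in> A)) * x (n + K) k \<omega>)"
        using sum_refine[OF descendants_bounded[OF R, of i] \<omega>, of "\<lambda>k. w (n + i) * of_bool ((i, k) \<in> A)" "K - i"]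
        unfolding * .
    qed
    also have "\<dots> = (\<Sum>k\<in>I. c k * x (n + K) k \<omega>)"
      by (subst sum.swap) (simp only: sum_distrib_right c_def)
    finally show ?thesis by (simp add: a_def sum_distrib_left mult.assoc)
  qed
  define E where "E B = {\<omega> \<in> space M. 1 < \<bar>\<Sum>k\<in>B. x (n + K) k \<omega>\<bar>}" for B
  have E: "E B \<in> events" if "B \<subseteq> I" for B
  proof -
    have [measurable]: "x (n + K) k \<in> borel_measurable M" if "k \<in> B" for k
      using that \<open>B \<subseteq> I\<close> xm unfolding I_def by auto
    show ?thesis unfolding E_def by measurable
  qed
  define G where "G B = space M - bad (n + K) (I - B)" for B
  have Ib: "I - B \<subseteq> {..<2 ^ (n + K)}" for B using descendants_bounded[OF R, of K] by (auto simp: I_def)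
  have G: "G B \<in> events" for B
    unfolding G_def using bad_sets[OF Ib] by auto
  have large: "1 / 224 * prob F \<le> subset_mean a I (\<lambda>B. prob (F \<inter> E B))"
  proof (rule subset_mean_prob_ge[OF _ E])
    fix \<omega> assume \<omega>F: "\<omega> \<in> F"
    then have \<omega>: "\<omega> \<in> space M" by (simp add: F_def E1_def)
    let ?y = "\<lambda>k. x (n + K) k \<omega>"
    let ?m = "\<Sum>k\<in>I. a k * ?y k" and ?v = "\<Sum>k\<in>I. a k * (1 - a k) * (?y k)\<^sup>2"
    have m: "4 \<le> ?m\<^sup>2"
    proof -
      have "(2 / \<theta>)\<^sup>2 \<le> (S \<omega>)\<^sup>2" using \<omega>F by (simp add: F_def E1_def)
      then have "\<theta>\<^sup>2 * (2 / \<theta>)\<^sup>2 \<le> \<theta>\<^sup>2 * (S \<omega>)\<^sup>2" by (intro mult_left_mono) auto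
      then show ?thesis using \<theta> unfolding mean[OF \<omega>] by (simp add: power_mult_distrib power_divide)
    qed
    have v: "0 \<le> ?v" using a1 by (intro sum_nonneg mult_nonneg_nonneg) auto
    have "(\<Sum>k\<in>I. a k * (1 - a k) * (?y k)^4) \<le> ?v"
    proof (rule sum_mono)
      fix k assume "k \<in> I"
      then have "k < 2 ^ (n + K)" using Ib[of "{}"] by auto
      then have "\<bar>?y k\<bar> \<le> 1" using \<omega>F by (simp add: F_def H_def)
      then have "\<bar>?y k\<bar>^4 \<le> \<bar>?y k\<bar>^2" by (intro power_decreasing) auto
      then have "(?y k)^4 \<le> (?y k)\<^sup>2" by simp
      then show "a k * (1 - a k) * (?y k)^4 \<le> a k * (1 - a k) * (?y k)\<^sup>2"
        using a1 by (intro mult_left_mono mult_nonneg_nonneg) auto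
    qed
    also have "?v \<le> ?m\<^sup>2 * ?v" using mult_right_mono[of 1 "?m\<^sup>2" ?v] m v by simp
    also have "\<dots> \<le> 4 * ?v\<^sup>2 + ?m\<^sup>2 * ?v" by simp
    finally have "1 / 224 \<le> subset_mean a I (\<lambda>B. of_bool ((?m\<^sup>2 + ?v) / 2 \<le> (\<Sum>k\<in>B. ?y k)\<^sup>2))"
      by (intro subset_Paley_Zygmund finI a1)
    also have "\<dots> \<le> subset_mean a I (\<lambda>B. of_bool (\<omega> \<in> E B))"
    proof (rule subset_mean_mono[OF a1])
      fix B
      have "1 < \<bar>s\<bar>" if "(?m\<^sup>2 + ?v) / 2 \<le> s\<^sup>2" for s
      proof -
        have "1 < r" if "(u + z) / 2 \<le> r" "4 \<le> u" "0 \<le> z" for r u z :: real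
          using that by simp
        from this[OF that m v] have "1 < s\<^sup>2" .
        then show ?thesis using abs_square_le_1[of s] by linarith
      qed
      then show "of_bool ((?m\<^sup>2 + ?v) / 2 \<le> (\<Sum>k\<in>B. ?y k)\<^sup>2) \<le> (of_bool (\<omega> \<in> E B) :: real)"
        using \<omega> by (simp add: E_def)
    qed
    finally show "1 / 224 \<le> subset_mean a I (\<lambda>B. of_bool (\<omega> \<in> E B))" .
  qed auto
  \<comment> \<open>infinite energy can be lost only if the one cell \<open>k\<close>, depending on \<open>\<omega>\<close>, is selected\<close>
  have survive: "subset_mean a I (\<lambda>B. prob (bad n R \<inter> G B)) \<le> \<theta> * \<pi>"
    unfolding \<pi>_def
  proof (rule subset_mean_prob_le[OF bad_sets[OF R] G])
    fix \<omega> assume "\<omega> \<in> bad n R"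
    then have \<omega>: "\<omega> \<in> space M" "energy (n + K) I \<omega> = \<infinity>"
      using energy_infinite_refine by (auto simp: bad_def I_def)
    obtain k where k: "k \<in> I" "energy (n + K) {k} \<omega> = \<infinity>"
      using energy_infinite_cell[OF finI \<omega>(2)] .
    have "subset_mean a I (\<lambda>B. of_bool (\<omega> \<in> G B)) \<le> subset_mean a I (\<lambda>B. of_bool (k \<in> B))"
    proof (rule subset_mean_mono[OF a1])
      fix B
      have "\<omega> \<notin> G B" if "k \<notin> B"
      proof -
        have "energy (n + K) {k} \<omega> \<le> energy (n + K) (I - B) \<omega>"
          using that k(1) finI by (intro energy_mono) auto
        then show ?thesis using k(2) \<omega>(1) by (simp add: G_def bad_def top_unique)
      qed
      then show "of_bool (\<omega> \<in> G B) \<le> (of_bool (k \<in> B) :: real)" by auto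
    qed
    also have "\<dots> = a k" by (rule subset_mean_member[OF finI k(1)])
    finally show "subset_mean a I (\<lambda>B. of_bool (\<omega> \<in> G B)) \<le> \<theta>" using a(2)[of k] by linarith
  qed
  have "\<beta> * \<pi> \<le> subset_mean a I (\<lambda>B. prob (F \<inter> E B) + (- (1 / \<tau>)) * prob (bad n R \<inter> G B))"
  proof -
    have "2 * (\<beta> * \<pi>) \<le> 1 / 224 * prob F" using PF by (simp add: \<beta>_def)
    moreover define X where "X = 1 / \<tau> * subset_mean a I (\<lambda>B. prob (bad n R \<inter> G B))"
    have "1 / \<tau> * subset_mean a I (\<lambda>B. prob (bad n R \<inter> G B)) \<le> 1 / \<tau> * (\<theta> * \<pi>)"
      using survive \<tau> by (intro mult_left_mono) auto
    then have "X \<le> \<beta> * \<pi>" using \<tau> by (simp add: X_def \<theta>_def)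
    moreover have "subset_mean a I (\<lambda>B. prob (F \<inter> E B) + (- (1 / \<tau>)) * prob (bad n R \<inter> G B))
        = subset_mean a I (\<lambda>B. prob (F \<inter> E B)) - X"
      unfolding subset_mean_add subset_mean_cmult X_def by simp
    ultimately show ?thesis using large by simp
  qed
  then obtain B where B: "B \<subseteq> I"
    "\<beta> * \<pi> \<le> prob (F \<inter> E B) + (- (1 / \<tau>)) * prob (bad n R \<inter> G B)"
    by (rule subset_mean_attained[OF a1 finI])
  have le: "prob (F \<inter> E B) \<le> prob (E B)"
    using E[OF B(1)] by (intro finite_measure_mono) auto
  have nn: "0 \<le> 1 / \<tau> * prob (bad n R \<inter> G B)" using \<tau> by simp
  have 1: "\<beta> * \<pi> \<le> prob (E B)" using B(2) le nn by linarith
  have "0 \<le> \<beta> * \<pi>" using \<beta> pos by (simp add: \<pi>_def)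
  then have "1 / \<tau> * prob (bad n R \<inter> G B) \<le> 1" using B(2) le prob_le_1[of "E B"] by linarith
  then have 2: "prob (bad n R \<inter> G B) \<le> \<tau>" using \<tau> by (simp add: field_simps)
  have "prob (bad n R) \<le> prob (bad (n + K) (I - B) \<union> (bad n R \<inter> G B))"
    using bad_sets[OF R] bad_sets[OF Ib] G
    by (intro finite_measure_mono) (auto simp: G_def bad_def)
  also have "\<dots> \<le> prob (bad (n + K) (I - B)) + prob (bad n R \<inter> G B)"
    using bad_sets[OF R] bad_sets[OF Ib] G by (intro measure_Un_le) auto
  finally have 3: "prob (bad n R) - \<tau> \<le> prob (bad (n + K) (I - B))" using 2 by linarith
  show thesis
  proof (rule that)
    show "B \<subseteq> descendants K R" using B(1) by (simp add: I_def)
    show "prob (bad n R) / (8 * 224\<^sup>2) \<le> prob {\<omega> \<in> space M. 1 < \<bar>\<Sum>k\<in>B. x (n + K) k \<omega>\<bar>}"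
      using 1 by (simp add: \<beta>_def \<pi>_def E_def)
    show "prob (bad n R) - \<tau> \<le> prob (bad (n + K) (descendants K R - B))"
      using 3 by (simp add: I_def)
  qed
qed

text \<open>
  If the energy were infinite with probability \<open>\<delta> > 0\<close>, thinning could be iterated with losses
  summing to at most \<open>\<delta> / 2\<close>. The sets removed in the process are disjoint, and the increments over
  them exceed \<open>1\<close> with probability bounded below, against exhaustivity.
\<close>
theorem energy_finite: "AE \<omega> in M. energy 0 {0} \<omega> < \<infinity>"
proof (rule ccontr)
  assume neg: "\<not> ?thesis"
  define \<delta> where "\<delta> = prob (bad 0 {0})"
  have R0: "{0} \<subseteq> {..<2 ^ 0 :: nat}" by simp
  have \<delta>: "0 < \<delta>"
  proof (rule ccontr)
    assume "\<not> 0 < \<delta>"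
    then have "prob (bad 0 {0}) = 0" using measure_nonneg[of M "bad 0 {0}"] by (simp add: \<delta>_def)
    then have "bad 0 {0} \<in> null_sets M"
      using bad_sets[OF R0] by (simp add: emeasure_eq_measure null_setsI)
    then have "AE \<omega> in M. \<omega> \<notin> bad 0 {0}" by (rule AE_not_in)
    then have "AE \<omega> in M. energy 0 {0} \<omega> < \<infinity>"
      by (rule AE_mp) (auto simp: bad_def less_top)
    then show False using neg by simp
  qed
  have \<delta>1: "\<delta> \<le> 1" unfolding \<delta>_def by simp
  \<comment> \<open>a state consists of a level, the set of cells that remain, and the set just removed; the bound on the
    remaining bad event decreases from \<open>\<delta>\<close> to \<open>\<delta> / 2\<close>\<close>
  define P where "P j s \<longleftrightarrow> (case s of (n, R, B) \<Rightarrow>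
    R \<subseteq> {..<2 ^ n} \<and> \<delta> / 2 + \<delta> / 2 * (1 / 2) ^ j \<le> prob (bad n R))" for j :: nat and s :: "nat \<times> nat set \<times> nat set"
  define Q where "Q s s' \<longleftrightarrow> (case (s, s') of ((n, R, _), (n', R', B')) \<Rightarrow>
    n \<le> n' \<and> B' \<subseteq> descendants (n' - n) R \<and> R' = descendants (n' - n) R - B' \<and>
    \<delta> / (16 * 224\<^sup>2) \<le> prob {\<omega> \<in> space M. 1 < \<bar>\<Sum>k\<in>B'. x n' k \<omega>\<bar>})"
    for s s' :: "nat \<times> nat set \<times> nat set"
  have "\<exists>s. \<forall>j. P j (s j) \<and> Q (s j) (s (Suc j))"
  proof (rule dependent_nat_choice)
    show "\<exists>s. P 0 s"
      by (rule exI[of _ "(0, {0}, {})"]) (simp add: P_def \<delta>_def)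
  next
    fix s j assume Ps: "P j s"
    obtain n R B0 where s: "s = (n, R, B0)" by (cases s)
    have R: "R \<subseteq> {..<2 ^ n}" and p: "\<delta> / 2 + \<delta> / 2 * (1 / 2) ^ j \<le> prob (bad n R)"
      using Ps by (auto simp: P_def s)
    have "0 < \<delta> / 2 * (1 / 2) ^ j" using \<delta> by simp
    with p have p2: "\<delta> / 2 \<le> prob (bad n R)" by linarith
    define \<tau> where "\<tau> = \<delta> / 2 * (1 / 2) ^ Suc j"
    have \<tau>: "0 < \<tau>" using \<delta> by (simp add: \<tau>_def)
    have \<tau>1: "\<tau> \<le> 1"
      unfolding \<tau>_def using \<delta> \<delta>1 by (intro mult_le_one power_le_one) auto
    have p0: "0 < prob (bad n R)" using p2 \<delta> by linarith
    obtain i B where iB: "B \<subseteq> descendants i R"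
      "prob (bad n R) / (8 * 224\<^sup>2) \<le> prob {\<omega> \<in> space M. 1 < \<bar>\<Sum>k\<in>B. x (n + i) k \<omega>\<bar>}"
      "prob (bad n R) - \<tau> \<le> prob (bad (n + i) (descendants i R - B))"
      by (rule thinning[OF R p0 \<tau> \<tau>1])
    have "P (Suc j) (n + i, descendants i R - B, B)"
      using descendants_bounded[OF R, of i] iB(3) p by (auto simp: P_def \<tau>_def)
    moreover have "Q s (n + i, descendants i R - B, B)"
      using iB(1,2) p2 by (auto simp: Q_def s)
    ultimately show "\<exists>s'. P (Suc j) s' \<and> Q s s'" by blast
  qed
  then obtain s where s: "\<And>j. P j (s j)" "\<And>j. Q (s j) (s (Suc j))" by blast
  define n where "n j = fst (s j)" for j
  define R where "R j = fst (snd (s j))" for j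
  define B where "B j = snd (snd (s j))" for j
  have Rb: "R j \<subseteq> {..<2 ^ n j}" for j
    using s(1)[of j] by (auto simp: P_def n_def R_def split: prod.splits)
  have step: "n j \<le> n (Suc j)" "B (Suc j) \<subseteq> descendants (n (Suc j) - n j) (R j)"
    "R (Suc j) = descendants (n (Suc j) - n j) (R j) - B (Suc j)"
    "\<delta> / (16 * 224\<^sup>2) \<le> prob {\<omega> \<in> space M. 1 < \<bar>\<Sum>k\<in>B (Suc j). x (n (Suc j)) k \<omega>\<bar>}" for j
    using s(2)[of j] by (auto simp: Q_def n_def R_def B_def split: prod.splits)
  note R_Suc = step(3)
  have nmono: "n i \<le> n j" if "i \<le> j" for i j
    using that step(1) by (rule lift_Suc_mono_le[rotated])
  have Rsub: "R j \<subseteq> descendants (n j - n i) (R i)" if "i \<le> j" for i j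
    using that
  proof (induction j rule: dec_induct)
    case (step j)
    have "R (Suc j) \<subseteq> descendants (n (Suc j) - n j) (R j)" unfolding R_Suc by blast
    also have "\<dots> \<subseteq> descendants (n (Suc j) - n j) (descendants (n j - n i) (R i))"
      by (intro descendants_mono step.IH)
    also have "\<dots> = descendants (n (Suc j) - n i) (R i)"
      using nmono[of i j] nmono[of j "Suc j"] step.hyps by (simp add: descendants_add)
    finally show ?case .
  qed simp
  have "(\<lambda>j. prob {\<omega> \<in> space M. 1 < \<bar>\<Sum>k\<in>B (Suc j). x (n (Suc j)) k \<omega>\<bar>}) \<longlonglongrightarrow> 0"
  proof (rule exhaustive)
    fix j
    have "B (Suc j) \<subseteq> descendants (n (Suc j) - n j) (R j)" by (rule step(2))
    also have "\<dots> \<subseteq> {..<2 ^ (n j + (n (Suc j) - n j))}" by (rule descendants_bounded[OF Rb])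
    finally show "B (Suc j) \<subseteq> {..<2 ^ n (Suc j)}" using step(1)[of j] by simp
  next
    fix i j :: nat assume ij: "i < j"
    have "B (Suc j) \<subseteq> descendants (n (Suc j) - n j) (R j)" by (rule step(2))
    also have "\<dots> \<subseteq> descendants (n (Suc j) - n j) (descendants (n j - n (Suc i)) (R (Suc i)))"
      using ij by (intro descendants_mono Rsub) auto
    also have "\<dots> = descendants (n (Suc j) - n (Suc i)) (R (Suc i))"
      using nmono[of "Suc i" j] step(1)[of j] ij by (simp add: descendants_add)
    finally show "n (Suc i) \<le> n (Suc j) \<and>
        descendants (n (Suc j) - n (Suc i)) (B (Suc i)) \<inter> B (Suc j) = {}"
      using nmono[of "Suc i" "Suc j"] ij step(3)[of i] by (auto simp: descendants_def)
  qed
  moreover have "0 < \<delta> / (16 * 224\<^sup>2)" using \<delta> by simp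
  ultimately have "\<forall>\<^sub>F j in sequentially. prob {\<omega> \<in> space M. 1 < \<bar>\<Sum>k\<in>B (Suc j). x (n (Suc j)) k \<omega>\<bar>} < \<delta> / (16 * 224\<^sup>2)"
    by (rule order_tendstoD)
  then obtain j where "prob {\<omega> \<in> space M. 1 < \<bar>\<Sum>k\<in>B (Suc j). x (n (Suc j)) k \<omega>\<bar>} < \<delta> / (16 * 224\<^sup>2)"
    by (auto simp: eventually_sequentially)
  then show False using step(4)[of j] by linarith
qed

end

section \<open>Finite additivity and exhaustivity of stochastic measures\<close>

text \<open>
  Partial sums of a disjoint sequence, available up to null sets and from some index \<open>N\<close> on, as they arise for
  finite unions padded with empty sets.
\<close>
lemma (in prob_space) stochastic_measure_tail:
  assumes \<mu>: "stochastic_measure M X B \<mu>" and A: "range A \<subseteq> B" "disjoint_family A"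
    and Y [measurable]: "\<And>n. Y n \<in> borel_measurable M"
    and part: "\<And>n. AE \<omega> in M. (\<Sum>k<n + N. \<mu> (A k) \<omega>) = Y n \<omega>" and \<epsilon>: "0 < \<epsilon>"
  shows "(\<lambda>n. prob {\<omega> \<in> space M. \<epsilon> < \<bar>Y n \<omega> - \<mu> (\<Union>n. A n) \<omega>\<bar>}) \<longlonglongrightarrow> 0"
proof -
  interpret S: sigma_algebra X B using \<mu> by (simp add: stochastic_measure_def)
  have \<mu>m: "\<mu> C \<in> borel_measurable M" if "C \<in> B" for C
    using \<mu> that by (auto simp: stochastic_measure_def)
  have [measurable]: "\<mu> (A k) \<in> borel_measurable M" for k using A by (intro \<mu>m) auto
  have [measurable]: "\<mu> (\<Union>n. A n) \<in> borel_measurable M" using A by (intro \<mu>m) auto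
  have "sums_in_probability M (\<lambda>n. \<mu> (A n)) (\<mu> (\<Union>n. A n))"
    using \<mu> A by (simp add: stochastic_measure_def)
  then have "(\<lambda>n. prob {\<omega> \<in> space M. \<epsilon> < \<bar>(\<Sum>k<n. \<mu> (A k) \<omega>) - \<mu> (\<Union>n. A n) \<omega>\<bar>}) \<longlonglongrightarrow> 0"
    using \<epsilon> by (simp add: sums_in_probability_def tendsto_in_probability_def)
  then have "(\<lambda>n. prob {\<omega> \<in> space M. \<epsilon> < \<bar>(\<Sum>k<n + N. \<mu> (A k) \<omega>) - \<mu> (\<Union>n. A n) \<omega>\<bar>}) \<longlonglongrightarrow> 0"
    by (rule LIMSEQ_ignore_initial_segment)
  moreover have "prob {\<omega> \<in> space M. \<epsilon> < \<bar>(\<Sum>k<n + N. \<mu> (A k) \<omega>) - \<mu> (\<Union>n. A n) \<omega>\<bar>}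
      = prob {\<omega> \<in> space M. \<epsilon> < \<bar>Y n \<omega> - \<mu> (\<Union>n. A n) \<omega>\<bar>}" for n
    by (rule finite_measure_eq_AE) (use part[of n] in auto)
  ultimately show ?thesis by simp
qed

lemma (in prob_space) AE_eq_if_prob_0:
  assumes [measurable]: "Y \<in> borel_measurable M"
    and zero: "\<And>\<epsilon>. 0 < \<epsilon> \<Longrightarrow> prob {\<omega> \<in> space M. \<epsilon> < \<bar>Y \<omega>\<bar>} = 0"
  shows "AE \<omega> in M. Y \<omega> = (0::real)"
proof -
  have "AE \<omega> in M. \<forall>n. \<not> (1 / real (Suc n) < \<bar>Y \<omega>\<bar>)"
  proof (rule AE_all_countable[THEN iffD2], rule allI)
    fix n
    have "{\<omega> \<in> space M. 1 / real (Suc n) < \<bar>Y \<omega>\<bar>} \<in> null_sets M"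
      using zero[of "1 / real (Suc n)"] by (intro null_setsI) (auto simp: emeasure_eq_measure)
    then show "AE \<omega> in M. \<not> (1 / real (Suc n) < \<bar>Y \<omega>\<bar>)"
      by (rule AE_I'[OF _ ]) auto
  qed
  then show ?thesis
  proof (rule AE_mp, intro AE_I2 impI)
    fix \<omega> assume *: "\<forall>n. \<not> (1 / real (Suc n) < \<bar>Y \<omega>\<bar>)"
    show "Y \<omega> = 0"
    proof (rule ccontr)
      assume "Y \<omega> \<noteq> 0"
      then have "0 < \<bar>Y \<omega>\<bar>" by simp
      then obtain n where "1 / real (Suc n) < \<bar>Y \<omega>\<bar>" by (rule nat_approx_posE)
      then show False using * by blast
    qed
  qed
qed

text \<open>
  For the constant sequence of empty sets the partial sums are multiples of \<open>\<mu> {}\<close>, and these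
  converge in probability only if \<open>\<mu> {}\<close> vanishes almost surely.
\<close>
lemma (in prob_space) stochastic_measure_empty:
  assumes \<mu>: "stochastic_measure M X B \<mu>"
  shows "AE \<omega> in M. \<mu> {} \<omega> = 0"
proof (rule AE_eq_if_prob_0)
  interpret S: sigma_algebra X B using \<mu> by (simp add: stochastic_measure_def)
  show [measurable]: "\<mu> {} \<in> borel_measurable M"
    using \<mu> S.empty_sets by (auto simp: stochastic_measure_def)
  fix \<epsilon> :: real assume \<epsilon>: "0 < \<epsilon>"
  have conv: "(\<lambda>n. prob {\<omega> \<in> space M. \<epsilon> < \<bar>real (n + 2) * \<mu> {} \<omega> - \<mu> {} \<omega>\<bar>}) \<longlonglongrightarrow> 0"
    using stochastic_measure_tail[OF \<mu>, where A = "\<lambda>_. {}" and N = 2 and Y = "\<lambda>n \<omega>. real (n + 2) * \<mu> {} \<omega>"]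
      \<epsilon> S.empty_sets by (simp add: disjoint_family_on_def)
  have le: "prob {\<omega> \<in> space M. \<epsilon> < \<bar>\<mu> {} \<omega>\<bar>}
      \<le> prob {\<omega> \<in> space M. \<epsilon> < \<bar>real (n + 2) * \<mu> {} \<omega> - \<mu> {} \<omega>\<bar>}" for n
  proof (rule finite_measure_mono)
    have "\<epsilon> < \<bar>real (n + 2) * \<mu> {} \<omega> - \<mu> {} \<omega>\<bar>" if "\<epsilon> < \<bar>\<mu> {} \<omega>\<bar>" for \<omega>
    proof -
      have "real (n + 2) * \<mu> {} \<omega> - \<mu> {} \<omega> = (1 + real n) * \<mu> {} \<omega>" by (simp add: algebra_simps)
      moreover have "1 * \<bar>\<mu> {} \<omega>\<bar> \<le> (1 + real n) * \<bar>\<mu> {} \<omega>\<bar>" by (intro mult_right_mono) auto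
      ultimately show ?thesis using that by (simp add: abs_mult)
    qed
    then show "{\<omega> \<in> space M. \<epsilon> < \<bar>\<mu> {} \<omega>\<bar>}
        \<subseteq> {\<omega> \<in> space M. \<epsilon> < \<bar>real (n + 2) * \<mu> {} \<omega> - \<mu> {} \<omega>\<bar>}"
      by (intro Collect_mono) simp
  qed measurable
  have "prob {\<omega> \<in> space M. \<epsilon> < \<bar>\<mu> {} \<omega>\<bar>} \<le> 0"
    by (rule LIMSEQ_le_const[OF conv]) (use le in simp)
  then show "prob {\<omega> \<in> space M. \<epsilon> < \<bar>\<mu> {} \<omega>\<bar>} = 0"
    using measure_nonneg[of M "{\<omega> \<in> space M. \<epsilon> < \<bar>\<mu> {} \<omega>\<bar>}"] by linarith
qed

lemma (in prob_space) stochastic_measure_Un: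
  assumes \<mu>: "stochastic_measure M X B \<mu>" and C: "C \<in> B" "D \<in> B" "C \<inter> D = {}"
  shows "AE \<omega> in M. \<mu> (C \<union> D) \<omega> = \<mu> C \<omega> + \<mu> D \<omega>"
proof -
  interpret S: sigma_algebra X B using \<mu> by (simp add: stochastic_measure_def)
  have \<mu>m: "\<mu> E \<in> borel_measurable M" if "E \<in> B" for E
    using \<mu> that by (auto simp: stochastic_measure_def)
  have [measurable]: "\<mu> C \<in> borel_measurable M" "\<mu> D \<in> borel_measurable M" "\<mu> (C \<union> D) \<in> borel_measurable M"
    using C S.Un by (auto intro!: \<mu>m)
  have "AE \<omega> in M. \<mu> C \<omega> + \<mu> D \<omega> - \<mu> (C \<union> D) \<omega> = 0"
  proof (rule AE_eq_if_prob_0)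
    fix \<epsilon> :: real assume \<epsilon>: "0 < \<epsilon>"
    have "(\<lambda>n. prob {\<omega> \<in> space M. \<epsilon> < \<bar>(\<mu> C \<omega> + \<mu> D \<omega>) - \<mu> (\<Union>n. binaryset C D n) \<omega>\<bar>}) \<longlonglongrightarrow> 0"
    proof (rule stochastic_measure_tail[OF \<mu> _ _ _ _ \<epsilon>, where N = 2])
      show "range (binaryset C D) \<subseteq> B" using C S.empty_sets by (auto simp: binaryset_def)
      show "disjoint_family (binaryset C D)" using C by (auto simp: disjoint_family_on_def binaryset_def)
      fix n
      show "AE \<omega> in M. (\<Sum>k<n + 2. \<mu> (binaryset C D k) \<omega>) = \<mu> C \<omega> + \<mu> D \<omega>"
        using stochastic_measure_empty[OF \<mu>]
      proof (rule AE_mp, intro AE_I2 impI)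
        fix \<omega> assume "\<mu> {} \<omega> = 0"
        then show "(\<Sum>k<n + 2. \<mu> (binaryset C D k) \<omega>) = \<mu> C \<omega> + \<mu> D \<omega>"
          by (induction n) (auto simp: binaryset_def numeral_2_eq_2)
      qed
    qed measurable
    then show "prob {\<omega> \<in> space M. \<epsilon> < \<bar>\<mu> C \<omega> + \<mu> D \<omega> - \<mu> (C \<union> D) \<omega>\<bar>} = 0"
      by (simp add: UN_binaryset_eq LIMSEQ_const_iff)
  qed measurable
  then show ?thesis by (rule AE_mp) (auto intro!: AE_I2)
qed

lemma (in prob_space) stochastic_measure_UN:
  assumes \<mu>: "stochastic_measure M X B \<mu>" and "finite K"
    and "\<And>k. k \<in> K \<Longrightarrow> A k \<in> B" and "disjoint_family_on A K"
  shows "AE \<omega> in M. \<mu> (\<Union>k\<in>K. A k) \<omega> = (\<Sum>k\<in>K. \<mu> (A k) \<omega>)"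
  using assms(2-)
proof (induction K rule: finite_induct)
  case empty
  then show ?case using stochastic_measure_empty[OF \<mu>] by simp
next
  case (insert k K)
  interpret S: sigma_algebra X B using \<mu> by (simp add: stochastic_measure_def)
  have "AE \<omega> in M. \<mu> (\<Union>k\<in>K. A k) \<omega> = (\<Sum>k\<in>K. \<mu> (A k) \<omega>)"
    using insert by (auto simp: disjoint_family_on_def)
  moreover have "AE \<omega> in M. \<mu> (A k \<union> (\<Union>k\<in>K. A k)) \<omega> = \<mu> (A k) \<omega> + \<mu> (\<Union>k\<in>K. A k) \<omega>"
  proof (rule stochastic_measure_Un[OF \<mu>])
    show "(\<Union>k\<in>K. A k) \<in> B" using insert by (intro S.finite_UN) auto
    show "A k \<inter> (\<Union>k\<in>K. A k) = {}" using insert by (auto simp: disjoint_family_on_def)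
  qed (use insert in auto)
  ultimately show ?case
    by eventually_elim (use insert.hyps in simp)
qed

lemma (in prob_space) stochastic_measure_exhaustive:
  assumes \<mu>: "stochastic_measure M X B \<mu>" and A: "range A \<subseteq> B" "disjoint_family A" and \<epsilon>: "0 < \<epsilon>"
  shows "(\<lambda>n. prob {\<omega> \<in> space M. \<epsilon> < \<bar>\<mu> (A n) \<omega>\<bar>}) \<longlonglongrightarrow> 0"
proof -
  interpret S: sigma_algebra X B using \<mu> by (simp add: stochastic_measure_def)
  have \<mu>m: "\<mu> E \<in> borel_measurable M" if "E \<in> B" for E
    using \<mu> that by (auto simp: stochastic_measure_def)
  have [measurable]: "\<mu> (A k) \<in> borel_measurable M" for k using A by (intro \<mu>m) auto
  have [measurable]: "\<mu> (\<Union>n. A n) \<in> borel_measurable M" using A by (intro \<mu>m) auto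
  define T where "T n = prob {\<omega> \<in> space M. \<epsilon> / 2 < \<bar>(\<Sum>k<n. \<mu> (A k) \<omega>) - \<mu> (\<Union>n. A n) \<omega>\<bar>}" for n
  have T: "T \<longlonglongrightarrow> 0"
    unfolding T_def by (rule stochastic_measure_tail[OF \<mu> A, where N = 0]) (use \<epsilon> in auto)
  have le: "prob {\<omega> \<in> space M. \<epsilon> < \<bar>\<mu> (A n) \<omega>\<bar>} \<le> T (Suc n) + T n" for n
  proof -
    have "prob {\<omega> \<in> space M. \<epsilon> < \<bar>\<mu> (A n) \<omega>\<bar>} \<le>
        prob ({\<omega> \<in> space M. \<epsilon> / 2 < \<bar>(\<Sum>k<Suc n. \<mu> (A k) \<omega>) - \<mu> (\<Union>n. A n) \<omega>\<bar>}
          \<union> {\<omega> \<in> space M. \<epsilon> / 2 < \<bar>(\<Sum>k<n. \<mu> (A k) \<omega>) - \<mu> (\<Union>n. A n) \<omega>\<bar>})"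
    proof (rule finite_measure_mono)
      have split: "\<epsilon> / 2 < \<bar>s + d - u\<bar> \<or> \<epsilon> / 2 < \<bar>s - u\<bar>" if "\<epsilon> < \<bar>d\<bar>" for s d u
        using that by linarith
      show "{\<omega> \<in> space M. \<epsilon> < \<bar>\<mu> (A n) \<omega>\<bar>} \<subseteq>
          {\<omega> \<in> space M. \<epsilon> / 2 < \<bar>(\<Sum>k<Suc n. \<mu> (A k) \<omega>) - \<mu> (\<Union>n. A n) \<omega>\<bar>}
          \<union> {\<omega> \<in> space M. \<epsilon> / 2 < \<bar>(\<Sum>k<n. \<mu> (A k) \<omega>) - \<mu> (\<Union>n. A n) \<omega>\<bar>}"
      proof
        fix \<omega> assume "\<omega> \<in> {\<omega> \<in> space M. \<epsilon> < \<bar>\<mu> (A n) \<omega>\<bar>}"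
        then show "\<omega> \<in> {\<omega> \<in> space M. \<epsilon> / 2 < \<bar>(\<Sum>k<Suc n. \<mu> (A k) \<omega>) - \<mu> (\<Union>n. A n) \<omega>\<bar>}
          \<union> {\<omega> \<in> space M. \<epsilon> / 2 < \<bar>(\<Sum>k<n. \<mu> (A k) \<omega>) - \<mu> (\<Union>n. A n) \<omega>\<bar>}"
          using split[of "\<mu> (A n) \<omega>" "\<Sum>k<n. \<mu> (A k) \<omega>" "\<mu> (\<Union>n. A n) \<omega>"] by simp
      qed
    qed measurable
    also have "\<dots> \<le> T (Suc n) + T n" unfolding T_def by (rule measure_Un_le) measurable
    finally show ?thesis .
  qed
  have "(\<lambda>n. T (Suc n) + T n) \<longlonglongrightarrow> 0"
    using tendsto_add[OF LIMSEQ_Suc[OF T] T] by simp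
  then show ?thesis
    by (rule Lim_null_comparison[rotated]) (use le in auto)
qed

section \<open>Dyadic increments of a stochastic measure\<close>

lemma dyadic_division:
  assumes "i \<le> j" "real k < z" "z \<le> real k + 1" "real k' < z * 2 ^ (j - i)" "z * 2 ^ (j - i) \<le> real k' + 1"
  shows "k' div 2 ^ (j - i) = k"
proof -
  let ?d = "2 ^ (j - i) :: nat"
  have "real k * 2 ^ (j - i) < real k' + 1" using assms(2,5)
    by (meson less_le_trans mult_strict_right_mono zero_less_numeral zero_less_power)
  then have "real (k * ?d) < real (k' + 1)" by simp
  then have 1: "k * ?d \<le> k'" by (simp only: of_nat_less_iff)
  have "real k' < (real k + 1) * 2 ^ (j - i)" using assms(3,4)
    by (meson less_le_trans mult_right_mono zero_le_numeral zero_le_power)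
  then have "real k' < real ((k + 1) * ?d)" by (simp add: algebra_simps)
  then have 2: "k' < (k + 1) * ?d" by (simp only: of_nat_less_iff)
  show ?thesis using 1 2 by (intro div_nat_eqI) (auto simp: mult.commute)
qed

locale stochastic_path = prob_space M for M :: "'w measure" +
  fixes a b :: real and \<mu> :: "real set \<Rightarrow> 'w \<Rightarrow> real" and X :: "real \<Rightarrow> 'w \<Rightarrow> real"
  assumes ab: "a < b"
    and \<mu>: "stochastic_measure M {a..b} (sets (restrict_space borel {a..b})) \<mu>"
    and X_measurable: "\<And>t. t \<in> {a..b} \<Longrightarrow> X t \<in> borel_measurable M"
    and X_eq: "\<And>t. t \<in> {a..b} \<Longrightarrow> AE \<omega> in M. X t \<omega> = \<mu> {a..t} \<omega>"
    and X_cont: "\<And>\<omega>. \<omega> \<in> space M \<Longrightarrow> continuous_on {a..b} (\<lambda>t. X t \<omega>)"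
begin

text \<open>
  The cells are half-open intervals \<open>{node n k<..node n (Suc k)}\<close>, because \<open>X\<close> represents the
  measure of the closed initial segments. The point \<open>a\<close> thus belongs to no cell.
\<close>
definition node :: "nat \<Rightarrow> nat \<Rightarrow> real" where
  "node n k = a + (b - a) * real k / 2 ^ n"

definition incr :: "nat \<Rightarrow> nat \<Rightarrow> 'w \<Rightarrow> real" where
  "incr n k \<omega> = X (node n (Suc k)) \<omega> - X (node n k) \<omega>"

lemma node_in: "k \<le> 2 ^ n \<Longrightarrow> node n k \<in> {a..b}"
proof -
  assume "k \<le> 2 ^ n"
  then have "real k / 2 ^ n \<le> 1" using of_nat_le_iff[of k "2 ^ n", where ?'a = real] by simp
  then have "(b - a) * (real k / 2 ^ n) \<le> (b - a) * 1" using ab by (intro mult_left_mono) auto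
  moreover have "0 \<le> (b - a) * (real k / 2 ^ n)" using ab by simp
  ultimately show ?thesis by (simp add: node_def)
qed

lemma node_mono: "node n k \<le> node n (Suc k)"
  using ab by (simp add: node_def divide_right_mono mult_left_mono)

lemma node_less_iff: "node n k < u \<longleftrightarrow> real k < (u - a) / (b - a) * 2 ^ n"
  using ab by (simp add: node_def field_simps)

lemma le_node_iff: "u \<le> node n k \<longleftrightarrow> (u - a) / (b - a) * 2 ^ n \<le> real k"
  using ab by (simp add: node_def field_simps)

lemma borel_Icc: "A \<in> sets borel \<Longrightarrow> A \<subseteq> {a..b} \<Longrightarrow> A \<in> sets (restrict_space borel {a..b})"
  by (simp add: sets_restrict_space_iff)

lemma incr_measure:
  assumes k: "k < 2 ^ n"
  shows "AE \<omega> in M. \<mu> {node n k<..node n (Suc k)} \<omega> = incr n k \<omega>"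
proof -
  let ?s = "node n k" and ?t = "node n (Suc k)"
  have st: "?s \<in> {a..b}" "?t \<in> {a..b}" using k by (intro node_in; simp)+
  have un: "{a..?s} \<union> {?s<..?t} = {a..?t}" using st node_mono[of n k] by auto
  have "AE \<omega> in M. \<mu> ({a..?s} \<union> {?s<..?t}) \<omega> = \<mu> {a..?s} \<omega> + \<mu> {?s<..?t} \<omega>"
    by (rule stochastic_measure_Un[OF \<mu>]) (use st in \<open>auto intro!: borel_Icc\<close>)
  with X_eq[OF st(1)] X_eq[OF st(2)] show ?thesis
    unfolding un by eventually_elim (simp add: incr_def)
qed

definition block :: "nat \<Rightarrow> nat set \<Rightarrow> real set" where
  "block n J = (\<Union>k\<in>J. {node n k<..node n (Suc k)})"

lemma block_sets: "J \<subseteq> {..<2 ^ n} \<Longrightarrow> block n J \<in> sets (restrict_space borel {a..b})"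
proof (rule borel_Icc)
  assume J: "J \<subseteq> {..<2 ^ n}"
  show "block n J \<in> sets borel" unfolding block_def by measurable
  show "block n J \<subseteq> {a..b}"
  proof
    fix u assume "u \<in> block n J"
    then obtain k where k: "k \<in> J" "node n k < u" "u \<le> node n (Suc k)" by (auto simp: block_def)
    then have "k < 2 ^ n" using J by auto
    then show "u \<in> {a..b}" using node_in[of k n] node_in[of "Suc k" n] k by auto
  qed
qed

lemma block_disjoint:
  assumes "i \<le> j" "descendants (j - i) B \<inter> B' = {}"
  shows "block i B \<inter> block j B' = {}"
proof (rule ccontr)
  assume "block i B \<inter> block j B' \<noteq> {}"
  then obtain u k k' where u: "k \<in> B" "node i k < u" "u \<le> node i (Suc k)"
    "k' \<in> B'" "node j k' < u" "u \<le> node j (Suc k')" by (auto simp: block_def)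
  have "(u - a) / (b - a) * 2 ^ j = (u - a) / (b - a) * 2 ^ i * 2 ^ (j - i)"
    using assms(1) by (simp flip: power_add)
  then have "k' div 2 ^ (j - i) = k"
    using u assms(1) unfolding node_less_iff le_node_iff
    by (intro dyadic_division[where z = "(u - a) / (b - a) * 2 ^ i"]) (auto simp: add.commute)
  then have "k' \<in> descendants (j - i) B" using u(1) by (simp add: descendants_def)
  then show False using assms(2) u(4) by blast
qed

lemma block_measure:
  assumes J: "J \<subseteq> {..<2 ^ n}"
  shows "AE \<omega> in M. \<mu> (block n J) \<omega> = (\<Sum>k\<in>J. incr n k \<omega>)"
proof -
  have cell: "block n {k} = {node n k<..node n (Suc k)}" for k by (simp add: block_def)
  have fin: "finite J" using finite_bounded[OF J] .
  have "AE \<omega> in M. \<mu> (\<Union>k\<in>J. block n {k}) \<omega> = (\<Sum>k\<in>J. \<mu> (block n {k}) \<omega>)"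
  proof (rule stochastic_measure_UN[OF \<mu> fin])
    show "disjoint_family_on (\<lambda>k. block n {k}) J"
      unfolding disjoint_family_on_def using block_disjoint[of n n] by auto
  qed (use J in \<open>auto intro!: block_sets\<close>)
  moreover have "AE \<omega> in M. \<forall>k\<in>J. \<mu> (block n {k}) \<omega> = incr n k \<omega>"
    unfolding cell using J fin by (intro AE_finite_allI incr_measure) auto
  moreover have "(\<Union>k\<in>J. block n {k}) = block n J" by (simp add: block_def)
  ultimately show ?thesis by (auto elim: eventually_elim2)
qed

lemma incr_dyadic_array:
  assumes w: "\<And>n. 0 \<le> w n" "\<And>N. (\<Sum>n<N. w n) \<le> 1"
  shows "dyadic_array M incr w"
proof
  show incr_m: "incr n k \<in> borel_measurable M" if "k < 2 ^ n" for n k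
    unfolding incr_def using that by (intro borel_measurable_diff X_measurable node_in) auto
  show "incr n k \<omega> = incr (Suc n) (2 * k) \<omega> + incr (Suc n) (2 * k + 1) \<omega>" for n k \<omega>
  proof -
    have "node (Suc n) (2 * k) = node n k" "node (Suc n) (Suc (2 * k + 1)) = node n (Suc k)"
      by (auto simp: node_def field_simps)
    then show ?thesis by (simp add: incr_def)
  qed
  show "\<forall>\<^sub>F n in sequentially. \<forall>k<2 ^ n. \<bar>incr n k \<omega>\<bar> \<le> 1" if \<omega>: "\<omega> \<in> space M" for \<omega>
  proof -
    have "uniformly_continuous_on {a..b} (\<lambda>t. X t \<omega>)"
      using X_cont[OF \<omega>] by (intro compact_uniformly_continuous) auto
    then obtain d where d: "0 < d"
      "\<And>s t. s \<in> {a..b} \<Longrightarrow> t \<in> {a..b} \<Longrightarrow> dist t s < d \<Longrightarrow> dist (X t \<omega>) (X s \<omega>) < 1"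
      unfolding uniformly_continuous_on_def by (metis zero_less_one)
    have "(\<lambda>n. (b - a) * (1 / 2) ^ n) \<longlonglongrightarrow> 0"
      by (rule tendsto_mult_right_zero, rule LIMSEQ_power_zero) simp
    then have "\<forall>\<^sub>F n in sequentially. (b - a) * (1 / 2) ^ n < d" using d(1) by (rule order_tendstoD)
    then show ?thesis
    proof (rule eventually_mono, intro allI impI)
      fix n k :: nat assume n: "(b - a) * (1 / 2) ^ n < d" and k: "k < 2 ^ n"
      have "node n (Suc k) - node n k = (b - a) * (1 / 2) ^ n"
        by (simp add: node_def field_simps)
      then have "dist (node n (Suc k)) (node n k) < d" using n node_mono[of n k] by (simp add: dist_real_def)
      then have "dist (X (node n (Suc k)) \<omega>) (X (node n k) \<omega>) < 1"
        using k by (intro d(2) node_in) auto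
      then show "\<bar>incr n k \<omega>\<bar> \<le> 1" by (simp add: incr_def dist_real_def)
    qed
  qed
  show "(\<lambda>j. prob {\<omega> \<in> space M. 1 < \<bar>\<Sum>k\<in>B j. incr (L j) k \<omega>\<bar>}) \<longlonglongrightarrow> 0"
    if B: "\<And>j. B j \<subseteq> {..<2 ^ L j}"
      and disj: "\<And>i j. i < j \<Longrightarrow> L i \<le> L j \<and> descendants (L j - L i) (B i) \<inter> B j = {}" for L B
  proof -
    have "(\<lambda>j. prob {\<omega> \<in> space M. 1 < \<bar>\<mu> (block (L j) (B j)) \<omega>\<bar>}) \<longlonglongrightarrow> 0"
    proof (rule stochastic_measure_exhaustive[OF \<mu>])
      show "range (\<lambda>j. block (L j) (B j)) \<subseteq> sets (restrict_space borel {a..b})"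
        using block_sets[OF B] by auto
      have less: "block (L i) (B i) \<inter> block (L j) (B j) = {}" if "i < j" for i j
        using disj[OF that] by (intro block_disjoint) auto
      show "disjoint_family (\<lambda>j. block (L j) (B j))"
        unfolding disjoint_family_on_def
      proof (intro ballI impI)
        fix i j :: nat assume "i \<noteq> j"
        then consider "i < j" | "j < i" by linarith
        then show "block (L i) (B i) \<inter> block (L j) (B j) = {}"
          using less[of i j] less[of j i] by cases auto
      qed
    qed simp
    moreover have "prob {\<omega> \<in> space M. 1 < \<bar>\<mu> (block (L j) (B j)) \<omega>\<bar>}
        = prob {\<omega> \<in> space M. 1 < \<bar>\<Sum>k\<in>B j. incr (L j) k \<omega>\<bar>}" for j
    proof (rule finite_measure_eq_AE)
      have [measurable]: "\<mu> (block (L j) (B j)) \<in> borel_measurable M"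
        using \<mu> block_sets[OF B] by (auto simp: stochastic_measure_def)
      have [measurable]: "incr (L j) k \<in> borel_measurable M" if "k \<in> B j" for k
        using that B[of j] by (intro incr_m) auto
      show "{\<omega> \<in> space M. 1 < \<bar>\<mu> (block (L j) (B j)) \<omega>\<bar>} \<in> events" by measurable
      show "{\<omega> \<in> space M. 1 < \<bar>\<Sum>k\<in>B j. incr (L j) k \<omega>\<bar>} \<in> events" by measurable
      show "AE \<omega> in M. (\<omega> \<in> {\<omega> \<in> space M. 1 < \<bar>\<mu> (block (L j) (B j)) \<omega>\<bar>})
          = (\<omega> \<in> {\<omega> \<in> space M. 1 < \<bar>\<Sum>k\<in>B j. incr (L j) k \<omega>\<bar>})"
        using block_measure[OF B[of j]] by eventually_elim simp
    qed
    ultimately show ?thesis by simp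
  qed
qed (use w in auto)

text \<open>
  The weights are \<open>(1 - r) * r ^ n\<close> with \<open>r\<^sup>2 = 2 powr (- \<epsilon>)\<close>. Each term of the convergent energy is bounded by its
  sum, so the square sum of level \<open>n\<close> is at most a constant times \<open>r powr (- 2 * n)\<close>.
\<close>
lemma square_sums_bounded:
  assumes \<epsilon>: "0 < \<epsilon>"
  shows "AE \<omega> in M. \<exists>C. \<forall>n. (\<Sum>k<2 ^ n. (incr n k \<omega>)\<^sup>2) \<le> C * (2 powr \<epsilon>) ^ n"
proof -
  define r where "r = 2 powr (- \<epsilon> / 2)"
  have r: "0 < r" "r < 1" using \<epsilon> by (auto simp: r_def powr_less_one)
  have r2: "r\<^sup>2 * 2 powr \<epsilon> = 1"
    by (simp add: r_def power2_eq_square flip: powr_add)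
  define w where "w n = (1 - r) * r ^ n" for n
  interpret dyadic_array M incr w
  proof (rule incr_dyadic_array)
    show "0 \<le> w n" for n using r by (simp add: w_def)
    show "(\<Sum>n<N. w n) \<le> 1" for N
    proof -
      have "(\<Sum>n<N. w n) = (1 - r) * (\<Sum>n<N. r ^ n)" by (simp add: w_def sum_distrib_left)
      also have "\<dots> = 1 - r ^ N" by (rule one_diff_power_eq[symmetric])
      also have "\<dots> \<le> 1" using r by simp
      finally show ?thesis .
    qed
  qed
  show ?thesis
    using energy_finite
  proof eventually_elim
    case (elim \<omega>)
    define c where "c = enn2real (energy 0 {0} \<omega>)"
    show ?case
    proof (intro exI allI)
      fix n
      let ?s = "\<Sum>k<2 ^ n. (incr n k \<omega>)\<^sup>2"
      have s0: "0 \<le> ?s" by (intro sum_nonneg) auto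
      have desc: "descendants n {0} = {..<2 ^ n}"
        by (auto simp: descendants_def div_eq_0_iff)
      have "(\<Sum>i\<in>{n}. ennreal ((w (0 + i))\<^sup>2 * (\<Sum>k\<in>descendants i {0}. (incr (0 + i) k \<omega>)\<^sup>2))) \<le> energy 0 {0} \<omega>"
        unfolding energy_def by (rule sum_le_suminf) auto
      then have "ennreal ((w n)\<^sup>2 * ?s) \<le> ennreal c"
        using elim by (simp add: desc c_def ennreal_enn2real less_top)
      then have "(w n)\<^sup>2 * ?s \<le> c" by (simp add: c_def)
      then have "(w n)\<^sup>2 * ?s * (2 powr \<epsilon>) ^ n \<le> c * (2 powr \<epsilon>) ^ n" by (intro mult_right_mono) auto
      also have "(w n)\<^sup>2 * ?s * (2 powr \<epsilon>) ^ n = (1 - r)\<^sup>2 * ?s * (r\<^sup>2 * 2 powr \<epsilon>) ^ n"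
        by (simp add: w_def power_mult_distrib mult_ac flip: power_mult)
      finally have "(1 - r)\<^sup>2 * ?s \<le> c * (2 powr \<epsilon>) ^ n" by (simp add: r2)
      then show "?s \<le> c / (1 - r)\<^sup>2 * (2 powr \<epsilon>) ^ n"
        using r by (simp add: field_simps)
    qed
  qed
qed

end

section \<open>Translates of a path with controlled dyadic increments\<close>

text \<open>
  The path is extended by constants outside \<open>[a, b]\<close>, so that integrals can be taken over the whole
  line, where they are invariant under translations, and so that increments over cells outside
  \<open>[a, b]\<close> vanish. The base \<open>2 * q\<close> of the growth of the square sums is chosen such that
  the integral of a squared step function of level \<open>n\<close> is of the order \<open>q ^ n\<close>.
\<close>
locale dyadic_path =
  fixes a b C q :: real and g :: "real \<Rightarrow> real"
  assumes ab: "a < b" and q: "0 < q" "q < 1"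
    and cont: "continuous_on UNIV g"
    and left: "\<And>x. x \<le> a \<Longrightarrow> g x = g a" and right: "\<And>x. b \<le> x \<Longrightarrow> g x = g b"
    and variation: "\<And>n. (\<Sum>k<2 ^ n. (g (a + (b - a) * (real k + 1) / 2 ^ n) - g (a + (b - a) * real k / 2 ^ n))\<^sup>2)
      \<le> C * (2 * q) ^ n"
begin

definition grid :: "nat \<Rightarrow> int \<Rightarrow> real" where
  "grid n k = a + (b - a) * of_int k / 2 ^ n"

definition cell :: "nat \<Rightarrow> real \<Rightarrow> int" where
  "cell n x = \<lfloor>(x - a) * 2 ^ n / (b - a)\<rfloor>"

definition width :: "nat \<Rightarrow> real" where
  "width n = (b - a) / 2 ^ n"

definition increment :: "nat \<Rightarrow> int \<Rightarrow> real" where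
  "increment n k = g (grid n (k + 1)) - g (grid n k)"

definition step :: "nat \<Rightarrow> real \<Rightarrow> real" where
  "step n x = g (grid n (cell n x))"

lemma width_pos: "0 < width n"
  using ab by (simp add: width_def)

lemma grid_Suc: "grid n (k + 1) = grid n k + width n"
  by (simp add: grid_def width_def field_simps)

lemma cell_eq_iff: "cell n x = k \<longleftrightarrow> grid n k \<le> x \<and> x < grid n (k + 1)"
proof -
  have "real_of_int k \<le> (x - a) * 2 ^ n / (b - a) \<longleftrightarrow> grid n k \<le> x"
    using ab by (simp add: grid_def field_simps)
  moreover have "(x - a) * 2 ^ n / (b - a) < real_of_int k + 1 \<longleftrightarrow> x < grid n (k + 1)"
    using ab by (simp add: grid_def field_simps)
  ultimately show ?thesis by (simp add: cell_def floor_eq_iff)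
qed

lemma cell_bounds: "grid n (cell n x) \<le> x" "x < grid n (cell n x) + width n"
  using cell_eq_iff[of n x "cell n x"] by (auto simp: grid_Suc)

lemma increment_outside:
  assumes "k < 0 \<or> 2 ^ n \<le> k" shows "increment n k = 0"
  using assms
proof
  assume "k < 0"
  have "grid n j \<le> a" if "j \<le> 0" for j
  proof -
    have "(b - a) * (of_int j / 2 ^ n) \<le> (b - a) * 0"
      using ab that by (intro mult_left_mono) (auto simp: divide_le_0_iff)
    then show ?thesis by (simp add: grid_def)
  qed
  then have "grid n k \<le> a" "grid n (k + 1) \<le> a" using \<open>k < 0\<close> by auto
  then show ?thesis using left[of "grid n k"] left[of "grid n (k + 1)"] by (simp add: increment_def)
next
  assume k: "2 ^ n \<le> k"
  have "b \<le> grid n j" if "2 ^ n \<le> j" for j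
  proof -
    have "(2::real) ^ n \<le> of_int j" using of_int_le_iff[of "2 ^ n" j, where ?'a = real] that by simp
    then have "(b - a) * 1 \<le> (b - a) * (of_int j / 2 ^ n)"
      using ab by (intro mult_left_mono) auto
    then show ?thesis by (simp add: grid_def)
  qed
  then have "b \<le> grid n k" "b \<le> grid n (k + 1)" using k by auto
  then show ?thesis using right[of "grid n k"] right[of "grid n (k + 1)"] by (simp add: increment_def)
qed

lemma variation': "(\<Sum>k<2 ^ n. (increment n (int k))\<^sup>2) \<le> C * (2 * q) ^ n"
  using variation[of n] by (simp add: increment_def grid_def)

lemma C_nonneg: "0 \<le> C"
proof -
  have "0 \<le> (\<Sum>k<2 ^ 0. (increment 0 (int k))\<^sup>2)" by (intro sum_nonneg) auto
  also have "\<dots> \<le> C" using variation'[of 0] by simp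
  finally show ?thesis .
qed

lemma cell_measurable [measurable]: "cell n \<in> measurable borel (count_space UNIV)"
  unfolding cell_def by measurable

lemma cell_fun_measurable [measurable]: "(\<lambda>x. G (cell n x) :: real) \<in> borel_measurable borel"
  by (rule measurable_compose[OF cell_measurable]) simp

lemma step_measurable [measurable]: "step n \<in> borel_measurable borel"
  using cell_fun_measurable[of "\<lambda>k. g (grid n k)" n] by (simp add: step_def[abs_def])

lemma g_measurable [measurable]: "g \<in> borel_measurable borel"
  using cont by (rule borel_measurable_continuous_onI)

lemma nn_integral_cell:
  assumes G: "\<And>k. 0 \<le> G k" "\<And>k. k < 0 \<or> 2 ^ n \<le> k \<Longrightarrow> G k = 0"
  shows "(\<integral>\<^sup>+x. ennreal (G (cell n x)) \<partial>lborel) = ennreal (width n * (\<Sum>k<2 ^ n. G (int k)))"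
proof -
  have "ennreal (G (cell n x))
      = (\<Sum>k<2 ^ n. ennreal (G (int k)) * indicator {grid n (int k)..<grid n (int k + 1)} x)" for x
  proof -
    have ind: "indicator {grid n (int k)..<grid n (int k + 1)} x = (if cell n x = int k then 1 else 0 :: ennreal)" for k
      using cell_eq_iff[of n x "int k"] by (auto simp: indicator_def)
    show ?thesis
    proof (cases "cell n x < 0 \<or> 2 ^ n \<le> cell n x")
      case True
      have "(if cell n x = int k then 1 else 0 :: ennreal) = 0" if "k < 2 ^ n" for k
      proof -
        have "int k < 2 ^ n" using that by (metis of_nat_less_iff of_nat_numeral of_nat_power)
        then show ?thesis using True by auto
      qed
      then show ?thesis using G(2)[OF True] unfolding ind by simp
    next
      case False
      then obtain j where j: "cell n x = int j" by (metis linorder_not_less nonneg_int_cases)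
      then have "j < 2 ^ n" using False by (metis linorder_not_less of_nat_less_iff of_nat_numeral of_nat_power)
      then have "(\<Sum>k<2 ^ n. ennreal (G (int k)) * (if cell n x = int k then 1 else 0))
          = (\<Sum>k<2 ^ n. if k = j then ennreal (G (int j)) else 0)"
        unfolding j by (intro sum.cong) auto
      then show ?thesis unfolding ind using \<open>j < 2 ^ n\<close> by (simp add: j)
    qed
  qed
  then have "(\<integral>\<^sup>+x. ennreal (G (cell n x)) \<partial>lborel)
      = (\<integral>\<^sup>+x. (\<Sum>k<2 ^ n. ennreal (G (int k)) * indicator {grid n (int k)..<grid n (int k + 1)} x) \<partial>lborel)"
    by (simp only:)
  also have "\<dots> = (\<Sum>k<2 ^ n. ennreal (G (int k)) * emeasure lborel {grid n (int k)..<grid n (int k + 1)})"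
    by (subst nn_integral_sum) (auto intro!: sum.cong nn_integral_cmult_indicator)
  also have "\<dots> = (\<Sum>k<2 ^ n. ennreal (G (int k) * width n))"
    using width_pos by (intro sum.cong refl) (simp add: grid_Suc ennreal_mult G less_imp_le)
  also have "\<dots> = ennreal (width n * (\<Sum>k<2 ^ n. G (int k)))"
    using G width_pos by (subst sum_ennreal) (auto simp: sum_distrib_left mult.commute less_imp_le)
  finally show ?thesis .
qed

lemma nn_integral_shift:
  assumes [measurable]: "f \<in> borel_measurable borel"
  shows "(\<integral>\<^sup>+x. f (x - h) \<partial>lborel) = (\<integral>\<^sup>+x. f (x::real) \<partial>lborel)"
  using nn_integral_real_affine[of f 1 "- h"] by simp

lemma increment_integral:
  "(\<integral>\<^sup>+x. ennreal ((increment n (cell n x))\<^sup>2) \<partial>lborel) \<le> ennreal ((b - a) * C * q ^ n)"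
proof -
  have "(\<integral>\<^sup>+x. ennreal ((increment n (cell n x))\<^sup>2) \<partial>lborel)
      = ennreal (width n * (\<Sum>k<2 ^ n. (increment n (int k))\<^sup>2))"
    by (rule nn_integral_cell) (use increment_outside in auto)
  also have "\<dots> \<le> ennreal (width n * (C * (2 * q) ^ n))"
    using variation' width_pos by (intro ennreal_leI mult_left_mono) (auto simp: less_imp_le)
  also have "width n * (C * (2 * q) ^ n) = (b - a) * C * q ^ n"
    by (simp add: width_def power_mult_distrib)
  finally show ?thesis .
qed

text \<open>
  The step functions of consecutive levels agree on the left half of each cell and differ on the right half by
  the increment over the left half.
\<close>
lemma step_refine:
  "(\<integral>\<^sup>+x. ennreal ((step (Suc n) x - step n x)\<^sup>2) \<partial>lborel) \<le> ennreal (2 * (b - a) * C * q ^ n)"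
proof -
  let ?G = "\<lambda>k. (increment (Suc n) (2 * k))\<^sup>2"
  have "(step (Suc n) x - step n x)\<^sup>2 \<le> ?G (cell n x)" for x
  proof -
    define i where "i = cell n x"
    have g0: "grid n i = grid (Suc n) (2 * i)" by (simp add: grid_def)
    have g1: "grid n (i + 1) = grid (Suc n) (2 * i + 1 + 1)" by (simp add: grid_def field_simps)
    have "grid (Suc n) (2 * i) \<le> x" "x < grid (Suc n) (2 * i + 1 + 1)"
      using cell_eq_iff[of n x i] unfolding g0[symmetric] g1[symmetric] by (auto simp: i_def)
    then have "cell (Suc n) x = 2 * i \<or> cell (Suc n) x = 2 * i + 1"
      using cell_eq_iff[of "Suc n" x "2 * i"] cell_eq_iff[of "Suc n" x "2 * i + 1"] by linarith
    then show ?thesis unfolding step_def i_def[symmetric] g0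
      by (auto simp: increment_def)
  qed
  then have "(\<integral>\<^sup>+x. ennreal ((step (Suc n) x - step n x)\<^sup>2) \<partial>lborel) \<le> (\<integral>\<^sup>+x. ennreal (?G (cell n x)) \<partial>lborel)"
    by (intro nn_integral_mono ennreal_leI)
  also have "\<dots> = ennreal (width n * (\<Sum>k<2 ^ n. ?G (int k)))"
    by (rule nn_integral_cell) (use increment_outside[of "2 * _" "Suc n"] in auto)
  also have "\<dots> \<le> ennreal (2 * (b - a) * C * q ^ n)"
  proof (rule ennreal_leI)
    have "(\<Sum>k<2 ^ n. ?G (int k)) = (\<Sum>k\<in>(\<lambda>k. 2 * k) ` {..<2 ^ n}. (increment (Suc n) (int k))\<^sup>2)"
      by (subst sum.reindex) (auto simp: inj_on_def)
    also have "\<dots> \<le> (\<Sum>k<2 ^ Suc n. (increment (Suc n) (int k))\<^sup>2)"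
      by (intro sum_mono2) auto
    also have "\<dots> \<le> C * (2 * q) ^ Suc n" by (rule variation')
    finally have "width n * (\<Sum>k<2 ^ n. ?G (int k)) \<le> width n * (C * (2 * q) ^ Suc n)"
      using width_pos by (intro mult_left_mono) (auto simp: less_imp_le)
    also have "\<dots> = 2 * (b - a) * C * q ^ n * q" by (simp add: width_def power_mult_distrib)
    also have "\<dots> \<le> 2 * (b - a) * C * q ^ n"
      using q ab C_nonneg by (intro mult_left_le) auto
    finally show "width n * (\<Sum>k<2 ^ n. ?G (int k)) \<le> 2 * (b - a) * C * q ^ n" .
  qed
  finally show ?thesis .
qed

text \<open>
  A translation by at most one cell width moves a point at most into a neighbouring cell, so the
  difference is the increment over the cell itself or over the preceding one, up to the sign.
\<close>
lemma step_translate: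
  assumes h: "\<bar>h\<bar> \<le> width n"
  shows "(\<integral>\<^sup>+x. ennreal ((step n (x - h) - step n x)\<^sup>2) \<partial>lborel) \<le> ennreal (2 * (b - a) * C * q ^ n)"
proof -
  let ?G = "\<lambda>x. ennreal ((increment n (cell n x))\<^sup>2)"
  have "ennreal ((step n (x - h) - step n x)\<^sup>2) \<le> ?G x + ?G (x - width n)" for x
  proof -
    define i where "i = cell n x"
    have i: "grid n i \<le> x" "x < grid n (i + 1)" using cell_eq_iff[of n x i] by (auto simp: i_def)
    have gp: "grid n i = grid n (i - 1) + width n" "grid n (i + 1) = grid n i + width n"
        "grid n (i + 1 + 1) = grid n (i + 1) + width n"
      using grid_Suc[of n "i - 1"] grid_Suc[of n i] grid_Suc[of n "i + 1"] by auto
    have "cell n (x - width n) = i - 1"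
      using i gp cell_eq_iff[of n "x - width n" "i - 1"] by simp
    moreover have "cell n (x - h) = i - 1 \<or> cell n (x - h) = i \<or> cell n (x - h) = i + 1"
      using i gp h cell_eq_iff[of n "x - h" "i - 1"] cell_eq_iff[of n "x - h" i] cell_eq_iff[of n "x - h" "i + 1"]
      by (simp add: abs_le_iff) linarith
    ultimately have "step n (x - h) - step n x = - increment n (cell n (x - width n)) \<or>
        step n (x - h) - step n x = 0 \<or> step n (x - h) - step n x = increment n (cell n x)"
      unfolding step_def i_def[symmetric] by (auto simp: increment_def)
    then have "(step n (x - h) - step n x)\<^sup>2 \<le> (increment n (cell n x))\<^sup>2 + (increment n (cell n (x - width n)))\<^sup>2"
      by (elim disjE) simp_all
    then have "ennreal ((step n (x - h) - step n x)\<^sup>2)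
        \<le> ennreal ((increment n (cell n x))\<^sup>2 + (increment n (cell n (x - width n)))\<^sup>2)"
      by (rule ennreal_leI)
    then show ?thesis by simp
  qed
  then have "(\<integral>\<^sup>+x. ennreal ((step n (x - h) - step n x)\<^sup>2) \<partial>lborel) \<le> (\<integral>\<^sup>+x. ?G x + ?G (x - width n) \<partial>lborel)"
    by (intro nn_integral_mono)
  also have "\<dots> = (\<integral>\<^sup>+x. ?G x \<partial>lborel) + (\<integral>\<^sup>+x. ?G (x - width n) \<partial>lborel)"
    by (intro nn_integral_add) measurable
  also have "(\<integral>\<^sup>+x. ?G (x - width n) \<partial>lborel) = (\<integral>\<^sup>+x. ?G x \<partial>lborel)"
    by (rule nn_integral_shift) measurable
  also have "(\<integral>\<^sup>+x. ?G x \<partial>lborel) + (\<integral>\<^sup>+x. ?G x \<partial>lborel)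
      \<le> ennreal ((b - a) * C * q ^ n) + ennreal ((b - a) * C * q ^ n)"
    by (intro add_mono increment_integral)
  also have "\<dots> = ennreal (2 * (b - a) * C * q ^ n)"
    using ab C_nonneg q by (subst ennreal_plus[symmetric]) auto
  finally show ?thesis .
qed

lemma square_add_le:
  fixes u v s :: real
  assumes "0 < s" shows "(u + v)\<^sup>2 \<le> (1 + 1 / s) * u\<^sup>2 + (1 + s) * v\<^sup>2"
proof -
  have "0 \<le> (u - s * v)\<^sup>2 / s" using assms by simp
  also have "\<dots> = 1 / s * u\<^sup>2 - 2 * u * v + s * v\<^sup>2"
    using assms by (simp add: power2_eq_square field_simps)
  finally show ?thesis by (simp add: power2_sum algebra_simps)
qed

text \<open>
  The fixed point of the recursion \<open>z = (1 + 1 / s) * D + (1 + s) * q * z\<close> that arises in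
  \<open>step_step\<close>, with \<open>D = 2 * (b - a) * C\<close> and \<open>s = (1 - q) / (2 * q)\<close>; for this \<open>s\<close> the factor
  \<open>(1 + s) * q\<close> equals \<open>(1 + q) / 2 < 1\<close>.
\<close>
definition step_error :: real where
  "step_error = (1 + 2 * q / (1 - q)) * (2 * (b - a) * C) * (2 / (1 - q))"

lemma step_error_nonneg: "0 \<le> step_error"
  unfolding step_error_def using ab q C_nonneg by (intro mult_nonneg_nonneg add_nonneg_nonneg) auto

text \<open>
  Chaining from level \<open>N\<close> down to level \<open>n\<close>. Since the refinement errors decay geometrically, the inequality
  \<open>(u + v)\<^sup>2 \<le> (1 + 1 / s) * u\<^sup>2 + (1 + s) * v\<^sup>2\<close> with small \<open>s\<close> can be iterated without losing
  the rate \<open>q ^ n\<close>.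
\<close>
lemma step_step:
  assumes "n \<le> N"
  shows "(\<integral>\<^sup>+x. ennreal ((step N x - step n x)\<^sup>2) \<partial>lborel) \<le> ennreal (step_error * q ^ n)"
  using assms
proof (induction n rule: inc_induct)
  case base
  then show ?case by simp
next
  case (step n)
  define s where "s = (1 - q) / (2 * q)"
  have s: "0 < s" using q by (simp add: s_def)
  let ?D = "2 * (b - a) * C"
  have D: "0 \<le> ?D" using ab C_nonneg by simp
  have Keq: "(1 + 1 / s) * ?D + (1 + s) * (step_error * q) = step_error"
  proof -
    have "(1 + 1 / s) * ?D = step_error * ((1 - q) / 2)" using q by (simp add: step_error_def s_def)
    moreover have "(1 + s) * (step_error * q) = step_error * ((1 + q) / 2)" using q by (simp add: s_def field_simps)
    ultimately show ?thesis by (simp add: field_simps)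
  qed
  let ?u = "\<lambda>x. step (Suc n) x - step n x" and ?v = "\<lambda>x. step N x - step (Suc n) x"
  have "(\<integral>\<^sup>+x. ennreal ((step N x - step n x)\<^sup>2) \<partial>lborel)
      \<le> (\<integral>\<^sup>+x. ennreal (1 + 1 / s) * ennreal ((?u x)\<^sup>2) + ennreal (1 + s) * ennreal ((?v x)\<^sup>2) \<partial>lborel)"
  proof (rule nn_integral_mono)
    fix x
    have "(step N x - step n x)\<^sup>2 \<le> (1 + 1 / s) * (?u x)\<^sup>2 + (1 + s) * (?v x)\<^sup>2"
      using square_add_le[OF s, of "?u x" "?v x"] by simp
    then have "ennreal ((step N x - step n x)\<^sup>2) \<le> ennreal ((1 + 1 / s) * (?u x)\<^sup>2 + (1 + s) * (?v x)\<^sup>2)"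
      by (rule ennreal_leI)
    also have "\<dots> = ennreal (1 + 1 / s) * ennreal ((?u x)\<^sup>2) + ennreal (1 + s) * ennreal ((?v x)\<^sup>2)"
      using s by (simp add: ennreal_plus ennreal_mult del: ennreal_plus[symmetric])
    finally show "ennreal ((step N x - step n x)\<^sup>2)
        \<le> ennreal (1 + 1 / s) * ennreal ((?u x)\<^sup>2) + ennreal (1 + s) * ennreal ((?v x)\<^sup>2)" .
  qed
  also have "\<dots> = ennreal (1 + 1 / s) * (\<integral>\<^sup>+x. ennreal ((?u x)\<^sup>2) \<partial>lborel)
      + ennreal (1 + s) * (\<integral>\<^sup>+x. ennreal ((?v x)\<^sup>2) \<partial>lborel)"
    by (subst nn_integral_add) (auto simp: nn_integral_cmult)
  also have "\<dots> \<le> ennreal (1 + 1 / s) * ennreal (?D * q ^ n) + ennreal (1 + s) * ennreal (step_error * q ^ Suc n)"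
    by (intro add_mono mult_left_mono step_refine step.IH) auto
  also have "\<dots> = ennreal ((1 + 1 / s) * (?D * q ^ n) + (1 + s) * (step_error * q ^ Suc n))"
    using s D step_error_nonneg q by (simp add: ennreal_plus ennreal_mult)
  also have "(1 + 1 / s) * (?D * q ^ n) + (1 + s) * (step_error * q ^ Suc n)
      = ((1 + 1 / s) * ?D + (1 + s) * (step_error * q)) * q ^ n"
    by (simp add: algebra_simps)
  finally show ?case unfolding Keq .
qed

lemma step_tendsto: "(\<lambda>N. step N x) \<longlonglongrightarrow> g x"
proof -
  have "(\<lambda>N. x - grid N (cell N x)) \<longlonglongrightarrow> 0"
  proof (rule Lim_null_comparison)
    show "\<forall>\<^sub>F N in sequentially. norm (x - grid N (cell N x)) \<le> (b - a) * (1 / 2) ^ N"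
    proof (rule always_eventually, rule allI)
      fix N :: nat
      show "norm (x - grid N (cell N x)) \<le> (b - a) * (1 / 2) ^ N"
        using cell_bounds[where n = N and x = x] by (simp add: width_def power_divide)
    qed
    show "(\<lambda>N. (b - a) * (1 / 2) ^ N) \<longlonglongrightarrow> 0"
      by (rule tendsto_mult_right_zero, rule LIMSEQ_power_zero) simp
  qed
  from tendsto_diff[OF tendsto_const[of x] this] have "(\<lambda>N. grid N (cell N x)) \<longlonglongrightarrow> x" by simp
  moreover have "isCont g x" using cont by (simp add: continuous_on_eq_continuous_at)
  ultimately show ?thesis unfolding step_def by (rule isCont_tendsto_compose[rotated])
qed

text \<open>Fatou's lemma, as the bound of \<open>step_step\<close> does not depend on \<open>N\<close>.\<close>
lemma step_limit:
  "(\<integral>\<^sup>+x. ennreal ((g x - step n x)\<^sup>2) \<partial>lborel) \<le> ennreal (step_error * q ^ n)"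
proof -
  have "ennreal ((g x - step n x)\<^sup>2) = liminf (\<lambda>N. ennreal ((step N x - step n x)\<^sup>2))" for x
  proof (rule lim_imp_Liminf[symmetric])
    show "(\<lambda>N. ennreal ((step N x - step n x)\<^sup>2)) \<longlonglongrightarrow> ennreal ((g x - step n x)\<^sup>2)"
      by (intro tendsto_ennrealI tendsto_power tendsto_diff step_tendsto tendsto_const)
  qed simp
  then have "(\<integral>\<^sup>+x. ennreal ((g x - step n x)\<^sup>2) \<partial>lborel)
      = (\<integral>\<^sup>+x. liminf (\<lambda>N. ennreal ((step N x - step n x)\<^sup>2)) \<partial>lborel)"
    by simp
  also have "\<dots> \<le> liminf (\<lambda>N. \<integral>\<^sup>+x. ennreal ((step N x - step n x)\<^sup>2) \<partial>lborel)"
    by (rule nn_integral_liminf) measurable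
  also have "\<dots> \<le> ennreal (step_error * q ^ n)"
    by (rule Liminf_le) (auto intro!: eventually_sequentiallyI[of n] step_step)
  finally show ?thesis .
qed

lemma translate_dyadic:
  assumes h: "\<bar>h\<bar> \<le> width n"
  shows "(\<integral>\<^sup>+x. ennreal ((g (x - h) - g x)\<^sup>2) \<partial>lborel) \<le> ennreal ((6 * step_error + 6 * (b - a) * C) * q ^ n)"
proof -
  let ?e = "\<lambda>x. ennreal ((g x - step n x)\<^sup>2)" and ?d = "\<lambda>x. ennreal ((step n (x - h) - step n x)\<^sup>2)"
  have "(\<integral>\<^sup>+x. ennreal ((g (x - h) - g x)\<^sup>2) \<partial>lborel) \<le> (\<integral>\<^sup>+x. ennreal 3 * ?e (x - h) + (ennreal 3 * ?d x + ennreal 3 * ?e x) \<partial>lborel)"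
  proof (rule nn_integral_mono)
    fix x
    have "(u + v + w)\<^sup>2 \<le> 3 * u\<^sup>2 + (3 * v\<^sup>2 + 3 * w\<^sup>2)" for u v w :: real
    proof -
      have "0 \<le> (u - v)\<^sup>2 + ((v - w)\<^sup>2 + (u - w)\<^sup>2)" by (intro add_nonneg_nonneg) auto
      then show ?thesis by (simp add: power2_eq_square algebra_simps)
    qed
    from this[of "g (x - h) - step n (x - h)" "step n (x - h) - step n x" "- (g x - step n x)"]
    have "(g (x - h) - g x)\<^sup>2 \<le> 3 * (g (x - h) - step n (x - h))\<^sup>2 + (3 * (step n (x - h) - step n x)\<^sup>2 + 3 * (g x - step n x)\<^sup>2)"
      by (simp only: power2_minus) simp
    then have "ennreal ((g (x - h) - g x)\<^sup>2) \<le> ennreal (3 * (g (x - h) - step n (x - h))\<^sup>2 + (3 * (step n (x - h) - step n x)\<^sup>2 + 3 * (g x - step n x)\<^sup>2))"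
      by (rule ennreal_leI)
    then show "ennreal ((g (x - h) - g x)\<^sup>2) \<le> ennreal 3 * ?e (x - h) + (ennreal 3 * ?d x + ennreal 3 * ?e x)"
      by (simp add: ennreal_mult)
  qed
  also have "\<dots> = ennreal 3 * (\<integral>\<^sup>+x. ?e (x - h) \<partial>lborel) + (ennreal 3 * (\<integral>\<^sup>+x. ?d x \<partial>lborel) + ennreal 3 * (\<integral>\<^sup>+x. ?e x \<partial>lborel))"
    by (simp add: nn_integral_add nn_integral_cmult)
  also have "(\<integral>\<^sup>+x. ?e (x - h) \<partial>lborel) = (\<integral>\<^sup>+x. ?e x \<partial>lborel)"
    by (rule nn_integral_shift) measurable
  also have "ennreal 3 * (\<integral>\<^sup>+x. ?e x \<partial>lborel) + (ennreal 3 * (\<integral>\<^sup>+x. ?d x \<partial>lborel) + ennreal 3 * (\<integral>\<^sup>+x. ?e x \<partial>lborel))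
    \<le> ennreal 3 * ennreal (step_error * q ^ n) + (ennreal 3 * ennreal (2 * (b - a) * C * q ^ n) + ennreal 3 * ennreal (step_error * q ^ n))"
    by (intro add_mono mult_left_mono step_limit step_translate h) auto
  also have "\<dots> = ennreal (3 * (step_error * q ^ n) + (3 * (2 * (b - a) * C * q ^ n) + 3 * (step_error * q ^ n)))"
  proof -
    have "ennreal 3 * ennreal u + (ennreal 3 * ennreal v + ennreal 3 * ennreal u) = ennreal (3 * u + (3 * v + 3 * u))"
      if "0 \<le> u" "0 \<le> v" for u v
    proof -
      have "ennreal (3 * u + (3 * v + 3 * u)) = ennreal (3 * u) + ennreal (3 * v + 3 * u)"
        using that by (intro ennreal_plus) auto
      also have "ennreal (3 * v + 3 * u) = ennreal (3 * v) + ennreal (3 * u)"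
        using that by (intro ennreal_plus) auto
      finally show ?thesis by (simp add: ennreal_mult')
    qed
    moreover have "0 \<le> step_error * q ^ n" "0 \<le> 2 * (b - a) * C * q ^ n" using step_error_nonneg ab C_nonneg q by auto
    ultimately show ?thesis by blast
  qed
  also have "3 * (step_error * q ^ n) + (3 * (2 * (b - a) * C * q ^ n) + 3 * (step_error * q ^ n)) = (6 * step_error + 6 * (b - a) * C) * q ^ n"
    by (simp add: algebra_simps)
  finally show ?thesis .
qed

end

section \<open>From translates to the Besov norm\<close>

lemma ennpowr_le:
  assumes "x \<le> ennreal y" "0 \<le> y" "0 \<le> r" shows "ennpowr x r \<le> ennreal (y powr r)"
proof -
  have "enn2real x \<le> y" using assms(1,2) by (rule enn2real_leI[rotated])
  then have "enn2real x powr r \<le> y powr r" using assms by (intro powr_mono2) auto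
  moreover have "x \<noteq> \<infinity>" using assms(1) by (auto simp: top_unique)
  ultimately show ?thesis by (simp add: ennpowr_def)
qed

lemma dyadic_scale:
  fixes y :: real
  assumes "1 \<le> y" obtains n where "2 ^ n \<le> y" "y < 2 ^ Suc n"
proof -
  define m where "m = \<lfloor>log 2 y\<rfloor>"
  have "0 \<le> m" using assms by (simp add: m_def)
  then obtain n where n: "m = int n" using nonneg_int_cases by blast
  have "real n \<le> log 2 y" "log 2 y < real (Suc n)"
    using n floor_correct[of "log 2 y"] by (auto simp: m_def)
  then have "2 powr real n \<le> y" "y < 2 powr real (Suc n)"
    using assms by (simp_all add: le_log_iff log_less_iff)
  then show thesis using that[of n] by (simp only: powr_realpow)
qed

text \<open>A translation by \<open>h\<close> is compared with the dyadic level whose cell width lies between \<open>t\<close> and \<open>2 * t\<close>.\<close>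
lemma (in dyadic_path) translate_power:
  assumes q_eq: "q = 2 powr (- \<gamma>)" and \<gamma>: "0 < \<gamma>"
  obtains L where "0 \<le> L"
    and "\<And>t h. 0 < t \<Longrightarrow> t \<le> b - a \<Longrightarrow> \<bar>h\<bar> \<le> t \<Longrightarrow>
      (\<integral>\<^sup>+x. ennreal ((g (x - h) - g x)\<^sup>2) \<partial>lborel) \<le> ennreal (L * t powr \<gamma>)"
proof -
  define A where "A = 6 * step_error + 6 * (b - a) * C"
  have A: "0 \<le> A" unfolding A_def using step_error_nonneg ab C_nonneg by simp
  show thesis
  proof (rule that)
    show "0 \<le> A * (2 / (b - a)) powr \<gamma>" using A by simp
    fix t h :: real assume t: "0 < t" "t \<le> b - a" and h: "\<bar>h\<bar> \<le> t"
    have "1 \<le> (b - a) / t" using t by simp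
    then obtain n where n: "2 ^ n \<le> (b - a) / t" "(b - a) / t < 2 ^ Suc n" by (rule dyadic_scale)
    have "t \<le> width n" using n(1) t by (simp add: width_def field_simps)
    then have "(\<integral>\<^sup>+x. ennreal ((g (x - h) - g x)\<^sup>2) \<partial>lborel) \<le> ennreal (A * q ^ n)"
      unfolding A_def using h by (intro translate_dyadic) simp
    also have "\<dots> \<le> ennreal (A * ((2 / (b - a)) powr \<gamma> * t powr \<gamma>))"
    proof (intro ennreal_leI mult_left_mono A)
      have "q ^ n = q powr real n" using q by (simp add: powr_realpow)
      also have "\<dots> = (2 powr (- real n)) powr \<gamma>" by (simp add: q_eq powr_powr mult.commute)
      also have "2 powr (- real n) = 1 / 2 ^ n" by (simp add: powr_minus_divide powr_realpow)
      also have "(1 / 2 ^ n) powr \<gamma> \<le> (2 / (b - a) * t) powr \<gamma>"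
      proof (rule powr_mono2)
        show "1 / 2 ^ n \<le> 2 / (b - a) * t" using n(2) t ab by (simp add: field_simps)
      qed (use \<gamma> in auto)
      also have "\<dots> = (2 / (b - a)) powr \<gamma> * t powr \<gamma>" by (rule powr_mult)
      finally show "q ^ n \<le> (2 / (b - a)) powr \<gamma> * t powr \<gamma>" .
    qed
    finally show "(\<integral>\<^sup>+x. ennreal ((g (x - h) - g x)\<^sup>2) \<partial>lborel)
        \<le> ennreal (A * (2 / (b - a)) powr \<gamma> * t powr \<gamma>)" by (simp add: mult.assoc)
  qed
qed

lemma Lp_norm_finite:
  assumes p: "0 < p" and bound: "\<And>x. x \<in> {a..b} \<Longrightarrow> \<bar>f x\<bar> \<le> B"
  shows "Lp_norm p a b f < \<infinity>"
proof (cases "a \<le> b")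
  case True
  then have B: "0 \<le> B" using bound[of a] by simp
  have "(\<integral>\<^sup>+x\<in>{a..b}. ennreal (\<bar>f x\<bar> powr p) \<partial>lebesgue) \<le> (\<integral>\<^sup>+x. ennreal (B powr p) * indicator {a..b} x \<partial>lebesgue)"
    using bound p by (intro nn_integral_mono) (auto simp: indicator_def intro!: powr_mono2 ennreal_leI)
  also have "\<dots> = ennreal (B powr p) * ennreal (b - a)"
    using True by (simp add: nn_integral_cmult_indicator)
  also have "\<dots> = ennreal (B powr p * (b - a))" using True by (simp add: ennreal_mult)
  finally have "Lp_norm p a b f \<le> ennreal ((B powr p * (b - a)) powr (1 / p))"
    unfolding Lp_norm_def using p True by (intro ennpowr_le) auto
  then show ?thesis by (rule le_less_trans) simp
next
  case False
  then show ?thesis by (simp add: Lp_norm_def ennpowr_def)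
qed

text \<open>
  Boundedness of the path reduces the exponent \<open>p\<close> to \<open>2\<close>, by
  \<open>\<bar>u\<bar> powr p \<le> (2 * B) powr (p - 2) * u\<^sup>2\<close>; this is where \<open>p \<ge> 2\<close> enters.
\<close>
lemma Lp_modulus_le:
  assumes p: "2 \<le> p" and t: "0 < t" and B: "0 \<le> B" and L: "0 \<le> L"
    and f: "\<And>x. x \<in> {a..b} \<Longrightarrow> f x = g x" and bound: "\<And>x. \<bar>g x\<bar> \<le> B"
    and g [measurable]: "g \<in> borel_measurable borel"
    and trans: "\<And>h. \<bar>h\<bar> \<le> t \<Longrightarrow> (\<integral>\<^sup>+x. ennreal ((g (x - h) - g x)\<^sup>2) \<partial>lborel) \<le> ennreal (L * t powr \<gamma>)"
  shows "ennpowr (Lp_modulus p a b t f) p \<le> ennreal ((2 * B) powr (p - 2) * L * t powr \<gamma>)"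
proof -
  let ?A = "(2 * B) powr (p - 2)"
  let ?I = "\<lambda>h. {x \<in> {a..b}. x - h \<in> {a..b}}"
  let ?R = "?A * L * t powr \<gamma>"
  have R: "0 \<le> ?R" using L by simp
  have int: "(\<integral>\<^sup>+x\<in>?I h. ennreal (\<bar>f (x - h) - f x\<bar> powr p) \<partial>lebesgue) \<le> ennreal ?R" if h: "\<bar>h\<bar> \<le> t" for h
  proof -
    have "(\<integral>\<^sup>+x\<in>?I h. ennreal (\<bar>f (x - h) - f x\<bar> powr p) \<partial>lebesgue)
        \<le> (\<integral>\<^sup>+x. ennreal ?A * ennreal ((g (x - h) - g x)\<^sup>2) \<partial>lebesgue)"
    proof (rule nn_integral_mono)
      fix x
      show "ennreal (\<bar>f (x - h) - f x\<bar> powr p) * indicator (?I h) x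
          \<le> ennreal ?A * ennreal ((g (x - h) - g x)\<^sup>2)"
      proof (cases "x \<in> ?I h")
        case True
        define u where "u = g (x - h) - g x"
        have fu: "f (x - h) - f x = u" using True f by (simp add: u_def)
        have uB: "\<bar>u\<bar> \<le> 2 * B" using bound[of x] bound[of "x - h"] unfolding u_def by linarith
        have "\<bar>u\<bar> powr p \<le> ?A * u\<^sup>2"
        proof (cases "u = 0")
          case False
          have "\<bar>u\<bar> powr p = \<bar>u\<bar> powr ((p - 2) + 2)" by simp
          also have "\<dots> = \<bar>u\<bar> powr (p - 2) * \<bar>u\<bar> powr 2" by (rule powr_add)
          also have "\<bar>u\<bar> powr 2 = u\<^sup>2" using False by (simp add: powr_numeral)
          also have "\<bar>u\<bar> powr (p - 2) * u\<^sup>2 \<le> ?A * u\<^sup>2"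
            using uB p by (intro mult_right_mono powr_mono2) auto
          finally show ?thesis .
        qed simp
        then have "ennreal (\<bar>u\<bar> powr p) \<le> ennreal (?A * u\<^sup>2)" by (rule ennreal_leI)
        then show ?thesis using True fu by (simp add: ennreal_mult u_def)
      qed simp
    qed
    also have "\<dots> = ennreal ?A * (\<integral>\<^sup>+x. ennreal ((g (x - h) - g x)\<^sup>2) \<partial>lborel)"
      by (simp add: nn_integral_completion nn_integral_cmult)
    also have "\<dots> \<le> ennreal ?A * ennreal (L * t powr \<gamma>)"
      by (intro mult_left_mono trans h) simp
    also have "\<dots> = ennreal ?R" using L by (simp add: ennreal_mult mult.assoc)
    finally show ?thesis .
  qed
  have "Lp_modulus p a b t f \<le> ennreal (?R powr (1 / p))"
    unfolding Lp_modulus_def using int R p by (intro SUP_least ennpowr_le) auto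
  then have "ennpowr (Lp_modulus p a b t f) p \<le> ennreal ((?R powr (1 / p)) powr p)"
    using p by (intro ennpowr_le) auto
  also have "(?R powr (1 / p)) powr p = ?R" using R p by (simp add: powr_powr)
  finally show ?thesis .
qed

lemma nn_integral_powr_from_0:
  fixes c e :: real
  assumes "- 1 < e" "0 \<le> c"
  shows "(\<integral>\<^sup>+t\<in>{0<..c}. ennreal (t powr e) \<partial>lebesgue) < \<infinity>"
proof -
  have "(\<integral>\<^sup>+t\<in>{0<..c}. ennreal (t powr e) \<partial>lebesgue) \<le> (\<integral>\<^sup>+t. ennreal (indicator {0..c} t * t powr e) \<partial>lborel)"
    unfolding nn_integral_completion by (intro nn_integral_mono) (auto simp: indicator_def)
  also have "\<dots> = ennreal (c powr (e + 1) / (e + 1))"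
    by (rule nn_integral_has_integral_lebesgue[OF _ has_integral_powr_from_0]) (use assms in auto)
  finally show ?thesis by (rule le_less_trans) simp
qed

text \<open>
  The integrand of the Besov norm is at most a constant times \<open>t powr (\<gamma> - \<alpha> * p - 1)\<close>, whose
  exponent exceeds \<open>- 1\<close>.
\<close>
lemma (in dyadic_path) besov:
  assumes q_eq: "q = 2 powr (- \<gamma>)" and p: "2 \<le> p" and \<alpha>: "0 < \<alpha>" "\<alpha> * p < \<gamma>"
    and f: "continuous_on {a..b} f" and fg: "\<And>x. x \<in> {a..b} \<Longrightarrow> f x = g x"
  shows "f \<in> besov_space \<alpha> p p a b"
proof -
  have \<gamma>: "0 < \<gamma>" using \<alpha> p by (smt (verit) mult_nonneg_nonneg)
  obtain L where L: "0 \<le> L" and trans: "\<And>t h. 0 < t \<Longrightarrow> t \<le> b - a \<Longrightarrow> \<bar>h\<bar> \<le> t \<Longrightarrow>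
      (\<integral>\<^sup>+x. ennreal ((g (x - h) - g x)\<^sup>2) \<partial>lborel) \<le> ennreal (L * t powr \<gamma>)"
    by (rule translate_power[OF q_eq \<gamma>]) blast
  have "bounded (f ` {a..b})"
    using f by (intro compact_imp_bounded compact_continuous_image) auto
  then obtain B where "\<forall>y\<in>f ` {a..b}. norm y \<le> B" unfolding bounded_iff ..
  then have B: "\<bar>f x\<bar> \<le> B" if "x \<in> {a..b}" for x using that by simp
  have gB: "\<bar>g x\<bar> \<le> B" for x
  proof -
    have in_ab: "\<bar>g y\<bar> \<le> B" if "y \<in> {a..b}" for y using B[OF that] fg[OF that] by simp
    consider "x \<le> a" | "b \<le> x" | "x \<in> {a..b}" by fastforce
    then show ?thesis
    proof cases
      case 1
      then show ?thesis using left[of x] in_ab[of a] ab by simp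
    next
      case 2
      then show ?thesis using right[of x] in_ab[of b] ab by simp
    qed (rule in_ab)
  qed
  have B0: "0 \<le> B" using gB[of a] by linarith
  define A where "A = (2 * B) powr (p - 2) * L"
  have A: "0 \<le> A" using L by (simp add: A_def)
  let ?e = "\<gamma> - \<alpha> * p - 1"
  have "(\<integral>\<^sup>+t\<in>{0<..b - a}. ennpowr (Lp_modulus p a b t f) p * ennreal (t powr (- \<alpha> * p - 1)) \<partial>lebesgue)
      \<le> (\<integral>\<^sup>+t. ennreal A * (ennreal (t powr ?e) * indicator {0<..b - a} t) \<partial>lebesgue)"
  proof (rule nn_integral_mono)
    fix t
    show "ennpowr (Lp_modulus p a b t f) p * ennreal (t powr (- \<alpha> * p - 1)) * indicator {0<..b - a} t
        \<le> ennreal A * (ennreal (t powr ?e) * indicator {0<..b - a} t)"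
    proof (cases "t \<in> {0<..b - a}")
      case True
      then have t: "0 < t" "t \<le> b - a" by auto
      have "ennpowr (Lp_modulus p a b t f) p \<le> ennreal (A * t powr \<gamma>)"
        unfolding A_def by (rule Lp_modulus_le[OF p t(1) B0 L fg gB g_measurable trans[OF t]])
      then have "ennpowr (Lp_modulus p a b t f) p * ennreal (t powr (- \<alpha> * p - 1))
          \<le> ennreal (A * t powr \<gamma>) * ennreal (t powr (- \<alpha> * p - 1))"
        by (rule mult_right_mono) simp
      also have "\<dots> = ennreal (A * (t powr \<gamma> * t powr (- \<alpha> * p - 1)))"
        using A by (simp add: ennreal_mult mult.assoc)
      also have "t powr \<gamma> * t powr (- \<alpha> * p - 1) = t powr ?e"
        by (simp add: algebra_simps flip: powr_add)
      also have "ennreal (A * t powr ?e) = ennreal A * ennreal (t powr ?e)"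
        using A by (simp add: ennreal_mult)
      finally show ?thesis using True by simp
    qed simp
  qed
  also have "\<dots> = ennreal A * (\<integral>\<^sup>+t\<in>{0<..b - a}. ennreal (t powr ?e) \<partial>lebesgue)"
    unfolding nn_integral_completion by (rule nn_integral_cmult) measurable
  also have "\<dots> < \<infinity>"
    using nn_integral_powr_from_0[of ?e "b - a"] \<alpha> ab by (simp add: ennreal_mult_less_top)
  finally have "ennpowr (\<integral>\<^sup>+t\<in>{0<..b - a}. ennpowr (Lp_modulus p a b t f) p * ennreal (t powr (- \<alpha> * p - 1)) \<partial>lebesgue) (1 / p) < \<infinity>"
    by (simp add: ennpowr_def)
  moreover have "Lp_norm p a b f < \<infinity>" using p B by (intro Lp_norm_finite) auto
  ultimately have "besov_norm \<alpha> p p a b f < \<infinity>"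
    unfolding besov_norm_def by simp
  then show ?thesis
    using f by (simp add: besov_space_def continuous_imp_measurable_on_sets_lebesgue)
qed

section \<open>Besov regularity of the paths\<close>

theorem mainTheorem1:
  fixes M :: "'w measure"
    and a b p \<alpha> :: real
    and \<mu> :: "real set \<Rightarrow> 'w \<Rightarrow> real"
    and X :: "real \<Rightarrow> 'w \<Rightarrow> real"
  assumes "prob_space M"
    and "a \<le> b"
    and "stochastic_measure M {a..b} (sets (restrict_space borel {a..b})) \<mu>"
    and "\<And>t. t \<in> {a..b} \<Longrightarrow> X t \<in> borel_measurable M"
    and "\<And>t. t \<in> {a..b} \<Longrightarrow> AE \<omega> in M. X t \<omega> = \<mu> {a..t} \<omega>"
    and "\<And>\<omega>. \<omega> \<in> space M \<Longrightarrow> continuous_on {a..b} (\<lambda>t. X t \<omega>)"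
    and "p \<ge> 2"
    and "0 < \<alpha>"
    and "\<alpha> < 1 / p"
  shows "AE \<omega> in M. (\<lambda>t. X t \<omega>) \<in> besov_space \<alpha> p p a b"
proof (cases "a < b")
  case False
  then have ab: "b = a" using assms(2) by simp
  show ?thesis
  proof (rule AE_I2)
    fix \<omega> assume \<omega>: "\<omega> \<in> space M"
    have "Lp_norm p a b (\<lambda>t. X t \<omega>) < \<infinity>"
      using assms(7) by (intro Lp_norm_finite[where B = "\<bar>X a \<omega>\<bar>"]) (auto simp: ab)
    then have "besov_norm \<alpha> p p a b (\<lambda>t. X t \<omega>) < \<infinity>"
      by (simp add: besov_norm_def ab ennpowr_def)
    then show "(\<lambda>t. X t \<omega>) \<in> besov_space \<alpha> p p a b"
      using assms(6)[OF \<omega>] by (simp add: besov_space_def continuous_imp_measurable_on_sets_lebesgue)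
  qed
next
  case True
  interpret prob_space M by (rule assms(1))
  interpret stochastic_path M a b \<mu> X by unfold_locales (use True assms(3-6) in auto)
  have \<alpha>p: "\<alpha> * p < 1" using assms(7,9) by (simp add: field_simps)
  \<comment> \<open>any exponent strictly between \<open>\<alpha> * p\<close> and \<open>1\<close> would do\<close>
  define \<gamma> where "\<gamma> = (1 + \<alpha> * p) / 2"
  have \<gamma>: "\<alpha> * p < \<gamma>" "\<gamma> < 1" using \<alpha>p by (auto simp: \<gamma>_def)
  have "0 < \<alpha> * p" using assms(7,8) by simp
  then have \<gamma>0: "0 < \<gamma>" using \<gamma> by linarith
  define q :: real where "q = 2 powr (- \<gamma>)"
  have q: "0 < q" "q < 1" using \<gamma>0 by (auto simp: q_def powr_less_one)
  have q2: "2 powr (1 - \<gamma>) = 2 * q" by (simp add: q_def powr_diff powr_minus field_simps)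
  have "AE \<omega> in M. \<exists>C. \<forall>n. (\<Sum>k<2 ^ n. (incr n k \<omega>)\<^sup>2) \<le> C * (2 * q) ^ n"
    using square_sums_bounded[of "1 - \<gamma>"] \<gamma> by (simp add: q2)
  then show ?thesis
  proof (rule AE_mp, intro AE_I2 impI)
    fix \<omega> assume \<omega>: "\<omega> \<in> space M"
      and "\<exists>C. \<forall>n. (\<Sum>k<2 ^ n. (incr n k \<omega>)\<^sup>2) \<le> C * (2 * q) ^ n"
    then obtain C where C: "\<And>n. (\<Sum>k<2 ^ n. (incr n k \<omega>)\<^sup>2) \<le> C * (2 * q) ^ n" by blast
    define g where "g x = X (max a (min b x)) \<omega>" for x
    have gX: "g x = X x \<omega>" if "x \<in> {a..b}" for x using that by (simp add: g_def)
    interpret dyadic_path a b C q g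
    proof
      show "continuous_on UNIV g" unfolding g_def
        by (rule continuous_on_compose2[OF X_cont[OF \<omega>]]) (use True in \<open>auto intro!: continuous_intros\<close>)
      show "(\<Sum>k<2 ^ n. (g (a + (b - a) * (real k + 1) / 2 ^ n) - g (a + (b - a) * real k / 2 ^ n))\<^sup>2)
          \<le> C * (2 * q) ^ n" for n
      proof -
        have "(g (a + (b - a) * (real k + 1) / 2 ^ n) - g (a + (b - a) * real k / 2 ^ n))\<^sup>2 = (incr n k \<omega>)\<^sup>2"
          if "k < 2 ^ n" for k
        proof -
          have "g (node n k) = X (node n k) \<omega>" "g (node n (Suc k)) = X (node n (Suc k)) \<omega>"
            using that by (intro gX node_in; simp)+
          then show ?thesis by (simp add: incr_def node_def add.commute)
        qed
        then show ?thesis using C[of n] by simp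
      qed
    qed (use True q in \<open>auto simp: g_def\<close>)
    show "(\<lambda>t. X t \<omega>) \<in> besov_space \<alpha> p p a b"
      by (rule besov[OF q_def assms(7,8) \<gamma>(1) X_cont[OF \<omega>]]) (simp add: gX)
  qed
qed

end
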